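(* For a Hamiltonian stationary torus $f$, the space $H^0_h$ of holomorphic sections with multiplier $h\in\mathrm{Spec}$ is generically complex one-dimensional (i.e. $\dim_{\mathbb C}H^0_h=1$ for all $h\in\mathrm{Spec}$ outside a discrete subset), and its complex dimension is bounded by $$\mathcal N=\Big|\mathcal D\cap\big(\Gamma^*+\tfrac{\beta_0}2\big)\Big|,$$ the number of points of the translated dual lattice $\Gamma^*+\frac{\beta_0}2$ in the closed disk $\mathcal D$ around $\frac{\beta_0}2$ of radius $|\beta_0|$. Moreover, there exists at least one multiplier $h$, namely the trivial multiplier, with $\dim_{\mathbb C}H^0_h\ge4$.
   Context: Identify $\mathbb R^4$ with $\mathbb H$ and $\mathbb C$ with $\mathrm{span}_{\mathbb R}\{1,i\}$; $\langle\cdot,\cdot\rangle$ is the Euclidean inner product on $\mathbb C\cong\mathbb R^2$. $\Gamma\subset\mathbb C$ a lattice, $\Gamma^*=\{\delta:\langle\delta,\gamma\rangle\in\mathbb Z\ \forall\gamma\in\Gamma\}$. A Hamiltonian stationary torus is a $\Gamma$-periodic conformal immersion $f:\mathbb C\to\mathbb H$ with $df=e^{j\beta/2}dz\,g$, $dz=dx+i\,dy$, $g$ nowhere zero, $\beta(z)=2\pi\langle\beta_0,z\rangle$ with $0\ne\beta_0\in\Gamma^*$. Convention $*dz=i\,dz$; left normal $N=e^{j\beta}i$. $\alpha:\mathbb C\to\mathbb H$ is holomorphic if $*d\alpha=N\,d\alpha$. For a homomorphism $h:\Gamma\to\mathbb C_*$, $H^0_h$ is the complex space (scalars on the right) of holomorphic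 $\alpha$ with $\alpha(z+\gamma)=\alpha(z)h(\gamma)$; $\mathrm{Spec}=\{h:H^0_h\ne0\}$. The trivial multiplier is $h\equiv1$. *)

theory Defs
  imports "HOL-Analysis.Analysis"
begin

text \<open>A quaternion a + j b (a, b in C = span{1,i}) is represented by the pair (a, b).
  Since j c = cnj c j for complex c, the product is
  (a + j b)(c + j d) = (a c - cnj b d) + j (cnj a d + b c).
  Right multiplication by a complex scalar c is componentwise: (a + j b) c = a c + j (b c).
  Addition, zero and the (Euclidean) norm are those of complex \<times> complex = R^4.\<close>

type_synonym quat = "complex \<times> complex"

definition qmul :: "quat \<Rightarrow> quat \<Rightarrow> quat" where
  "qmul p q = (fst p * fst q - cnj (snd p) * snd q, cnj (fst p) * snd q + snd p * fst q)"

definition qofc :: "complex \<Rightarrow> quat" where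
  "qofc c = (c, 0)"

definition qj :: quat where
  "qj = (0, 1)"

definition rscale :: "quat \<Rightarrow> complex \<Rightarrow> quat" where
  "rscale q c = qmul q (qofc c)"

definition expj :: "real \<Rightarrow> quat" where
  "expj t = (complex_of_real (cos t), complex_of_real (sin t))"

definition lattice :: "complex \<Rightarrow> complex \<Rightarrow> complex set" where
  "lattice \<omega>1 \<omega>2 = {of_int m * \<omega>1 + of_int n * \<omega>2 | m n. True}"

definition is_lattice_basis :: "complex \<Rightarrow> complex \<Rightarrow> bool" where
  "is_lattice_basis \<omega>1 \<omega>2 \<longleftrightarrow> Im (cnj \<omega>1 * \<omega>2) \<noteq> 0"

definition dual_lattice :: "complex set \<Rightarrow> complex set" where
  "dual_lattice \<Gamma> = {\<delta>. \<forall>\<gamma>\<in>\<Gamma>. inner \<delta> \<gamma> \<in> \<int>}"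

definition betaf :: "complex \<Rightarrow> complex \<Rightarrow> real" where
  "betaf \<beta>0 z = 2 * pi * inner \<beta>0 z"

definition normalN :: "complex \<Rightarrow> complex \<Rightarrow> quat" where
  "normalN \<beta>0 z = qmul (expj (betaf \<beta>0 z)) (qofc \<i>)"

definition HS_torus :: "complex set \<Rightarrow> complex \<Rightarrow> (complex \<Rightarrow> quat) \<Rightarrow> (complex \<Rightarrow> quat) \<Rightarrow> bool" where
  "HS_torus \<Gamma> \<beta>0 f g \<longleftrightarrow>
     \<beta>0 \<noteq> 0 \<and> \<beta>0 \<in> dual_lattice \<Gamma> \<and>
     (\<forall>z. \<forall>\<gamma>\<in>\<Gamma>. f (z + \<gamma>) = f z) \<and>
     (\<forall>z. g z \<noteq> 0) \<and>
     (\<forall>z. (f has_derivative (\<lambda>v. qmul (qmul (expj (betaf \<beta>0 z / 2)) (qofc v)) (g z))) (at z))"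

text \<open>alpha is holomorphic: (continuously) differentiable with *d alpha = N d alpha, where
  ( *\<omega>)(v) = \<omega>(i v) (so that *dz = i dz).\<close>
definition holomorphic_q :: "complex \<Rightarrow> (complex \<Rightarrow> quat) \<Rightarrow> bool" where
  "holomorphic_q \<beta>0 \<alpha> \<longleftrightarrow>
     (\<exists>D. (\<forall>z. (\<alpha> has_derivative D z) (at z)) \<and>
          (\<forall>v. continuous_on UNIV (\<lambda>z. D z v)) \<and>
          (\<forall>z v. D z (\<i> * v) = qmul (normalN \<beta>0 z) (D z v)))"

text \<open>Multipliers: homomorphisms \<Gamma> \<rightarrow> C_*, represented extensionally (value 1 off \<Gamma>).\<close>
definition is_multiplier :: "complex set \<Rightarrow> (complex \<Rightarrow> complex) \<Rightarrow> bool" where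
  "is_multiplier \<Gamma> h \<longleftrightarrow>
     (\<forall>\<gamma>\<in>\<Gamma>. h \<gamma> \<noteq> 0) \<and>
     (\<forall>\<gamma>\<in>\<Gamma>. \<forall>\<gamma>'\<in>\<Gamma>. h (\<gamma> + \<gamma>') = h \<gamma> * h \<gamma>') \<and>
     (\<forall>z. z \<notin> \<Gamma> \<longrightarrow> h z = 1)"

definition H0 :: "complex set \<Rightarrow> complex \<Rightarrow> (complex \<Rightarrow> complex) \<Rightarrow> (complex \<Rightarrow> quat) set" where
  "H0 \<Gamma> \<beta>0 h = {\<alpha>. holomorphic_q \<beta>0 \<alpha> \<and> (\<forall>z. \<forall>\<gamma>\<in>\<Gamma>. \<alpha> (z + \<gamma>) = rscale (\<alpha> z) (h \<gamma>))}"

definition Spec :: "complex set \<Rightarrow> complex \<Rightarrow> (complex \<Rightarrow> complex) set" where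
  "Spec \<Gamma> \<beta>0 = {h. is_multiplier \<Gamma> h \<and> H0 \<Gamma> \<beta>0 h \<noteq> {\<lambda>z. 0}}"

definition c_indep_n :: "(complex \<Rightarrow> quat) set \<Rightarrow> nat \<Rightarrow> bool" where
  "c_indep_n S n \<longleftrightarrow>
     (\<exists>a :: nat \<Rightarrow> complex \<Rightarrow> quat. (\<forall>k<n. a k \<in> S) \<and>
        (\<forall>c :: nat \<Rightarrow> complex. (\<forall>z. (\<Sum>k<n. rscale (a k z) (c k)) = 0) \<longrightarrow> (\<forall>k<n. c k = 0)))"

definition cdim :: "(complex \<Rightarrow> quat) set \<Rightarrow> enat" where
  "cdim S = Sup {enat n | n. c_indep_n S n}"

text \<open>Hom(\<Gamma>, C_* ) is topologised via the values on the basis \<omega>1, \<omega>2 (i.e. as (C_* )^2).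
  A subset D of Spec is discrete (closed discrete in Spec): every point of Spec has a
  neighbourhood meeting D in finitely many points.\<close>
definition discrete_in :: "complex \<Rightarrow> complex \<Rightarrow> (complex \<Rightarrow> complex) set \<Rightarrow> (complex \<Rightarrow> complex) set \<Rightarrow> bool" where
  "discrete_in \<omega>1 \<omega>2 D S \<longleftrightarrow>
     (\<forall>h\<in>S. \<exists>e>0. finite {h'\<in>D. cmod (h' \<omega>1 - h \<omega>1) < e \<and> cmod (h' \<omega>2 - h \<omega>2) < e})"

definition boundN :: "complex set \<Rightarrow> complex \<Rightarrow> nat" where
  "boundN \<Gamma> \<beta>0 = card ({\<delta> + \<beta>0 / 2 | \<delta>. \<delta> \<in> dual_lattice \<Gamma>} \<inter> cball (\<beta>0 / 2) (cmod \<beta>0))"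

end

theory Submission
  imports Defs
begin

text \<open>
  Write a section as \<open>\<alpha> = a + j b\<close> and put
  \<open>U, V = exp (- i \<beta> / 2) (a + i b) \<mp> exp (i \<beta> / 2) (a - i b)\<close>. Then \<open>\<alpha>\<close> is holomorphic iff
  \<open>(U, V)\<close> solves a Dirac equation with constant coefficients. If
  \<open>h(\<gamma>) = exp (\<pi> i (x \<gamma> + y cnj \<gamma>))\<close> up to the sign by which \<open>exp (i \<beta> / 2)\<close> changes under \<open>\<gamma>\<close>,
  the equation decouples over the Fourier modes of \<open>U, V\<close>, and the mode \<open>\<delta> \<in> \<Gamma>\<^sup>*\<close> carries a
  solution, unique up to scaling, iff \<open>(x + cnj \<delta>)(y + \<delta>) = |\<beta>0|\<^sup>2 / 4\<close>. So the dimension is at most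
  the number of such \<open>\<delta>\<close>. Normalising \<open>x y = |\<beta>0|\<^sup>2 / 4\<close>, these are lattice points of the closed
  disk of radius \<open>|\<beta>0|\<close> around \<open>0\<close> if \<open>|x| = |y|\<close>, and at most two points otherwise. A second
  resonance restricts \<open>(x, y)\<close> to finitely many values for each \<open>\<delta>\<close>, which gives discreteness. For
  the trivial multiplier \<open>1, j, f, f j\<close> are independent.
\<close>

section \<open>Vanishing integrals of periodic derivatives\<close>

text \<open>Left multiplication by \<open>j\<close> acts on \<open>a + i b\<close> and
  \<open>a - i b\<close> as the scalars \<open>i\<close> and \<open>- i\<close>, and left
  multiplication by \<open>i\<close> exchanges the two up to the factor \<open>i\<close>. The
  half-angle phases therefore turn the variable normal \<open>N\<close> into a constant swap.
  \<open>U\<close> and \<open>V\<close> are the eigencomponents of this swap, and differentiating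
  the phases produces the constant potential of the Dirac equation. The obstacle is regularity:
  \<open>HS_torus\<close> gives \<open>f\<close> a derivative at every point but not its continuity,
  while \<open>H0\<close> asks for continuity. The Dirac equation expresses the z-derivative of
  \<open>U\<close> and the conjugate derivative of \<open>V\<close> by continuous functions; the
  other two Wirtinger derivatives are not known to be continuous. Hence the Fourier modes are
  reached through a Green formula that assumes continuity of a single combination of partial
  derivatives, and through density of trigonometric polynomials among continuous functions.\<close>

definition flux_defect ::
  "(real \<times> real \<Rightarrow> complex) \<Rightarrow> (real \<times> real \<Rightarrow> complex) \<Rightarrow> complex \<Rightarrow> complex \<Rightarrow>
    real \<Rightarrow> real \<Rightarrow> real \<Rightarrow> real \<Rightarrow> complex" where
  "flux_defect w g c1 c2 a a' b b' =
     c1 * integral {b..b'} (\<lambda>t. w (a', t) - w (a, t)) +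
     c2 * integral {a..a'} (\<lambda>s. w (s, b') - w (s, b)) -
     integral (cbox (a, b) (a', b')) g"

lemma integral_cbox_split_fst:
  fixes g :: "real \<times> real \<Rightarrow> complex"
  assumes g: "continuous_on UNIV g" and "a \<le> m" "m \<le> a'"
  shows "integral (cbox (a, b) (a', b')) g =
         integral (cbox (a, b) (m, b')) g + integral (cbox (m, b) (a', b')) g"
proof -
  have int: "g integrable_on cbox x y" for x y
    by (rule integrable_continuous) (rule continuous_on_subset[OF g], simp)
  have 1: "cbox (a, b) (a', b') \<inter> {x. x \<bullet> (1, 0) \<le> m} = cbox (a, b) (m, b')"
    using assms by (auto simp: cbox_Pair_eq)
  have 2: "cbox (a, b) (a', b') \<inter> {x. x \<bullet> (1, 0) \<ge> m} = cbox (m, b) (a', b')"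
    using assms by (auto simp: cbox_Pair_eq)
  have k: "(1::real, 0::real) \<in> Basis" by (auto simp: Basis_prod_def)
  have "(g has_integral (integral (cbox (a, b) (m, b')) g + integral (cbox (m, b) (a', b')) g))
        (cbox (a, b) (a', b'))"
    by (rule has_integral_split[where c = m, OF _ _ k]) (use int in \<open>auto simp: 1 2 intro!: integrable_integral\<close>)
  then show ?thesis by (rule integral_unique)
qed

lemma integral_cbox_split_snd:
  fixes g :: "real \<times> real \<Rightarrow> complex"
  assumes g: "continuous_on UNIV g" and "b \<le> m" "m \<le> b'"
  shows "integral (cbox (a, b) (a', b')) g =
         integral (cbox (a, b) (a', m)) g + integral (cbox (a, m) (a', b')) g"
proof -
  have int: "g integrable_on cbox x y" for x y
    by (rule integrable_continuous) (rule continuous_on_subset[OF g], simp)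
  have 1: "cbox (a, b) (a', b') \<inter> {x. x \<bullet> (0, 1) \<le> m} = cbox (a, b) (a', m)"
    using assms by (auto simp: cbox_Pair_eq)
  have 2: "cbox (a, b) (a', b') \<inter> {x. x \<bullet> (0, 1) \<ge> m} = cbox (a, m) (a', b')"
    using assms by (auto simp: cbox_Pair_eq)
  have k: "(0::real, 1::real) \<in> Basis" by (auto simp: Basis_prod_def)
  have "(g has_integral (integral (cbox (a, b) (a', m)) g + integral (cbox (a, m) (a', b')) g))
        (cbox (a, b) (a', b'))"
    by (rule has_integral_split[where c = m, OF _ _ k]) (use int in \<open>auto simp: 1 2 intro!: integrable_integral\<close>)
  then show ?thesis by (rule integral_unique)
qed

text \<open>The defect measures the failure of Green's formula on a rectangle: boundary flux of the
  field \<open>(c1 * w, c2 * w)\<close> minus the area integral of its presumed divergence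
  \<open>g\<close>. Fluxes through inner edges cancel, so it is additive under subdivision.\<close>

lemma flux_defect_split:
  assumes w: "continuous_on UNIV w" and g: "continuous_on UNIV g"
    and "a \<le> m" "m \<le> a'" "b \<le> n" "n \<le> b'"
  shows "flux_defect w g c1 c2 a a' b b' =
    flux_defect w g c1 c2 a m b n + flux_defect w g c1 c2 m a' b n +
    flux_defect w g c1 c2 a m n b' + flux_defect w g c1 c2 m a' n b'"
proof -
  have wc: "continuous_on A (\<lambda>t. w (s, t))" "continuous_on A (\<lambda>s. w (s, t))" for s t A
    by (rule continuous_on_compose2[OF w]; force intro!: continuous_intros)+
  have i: "(\<lambda>t. w (s, t)) integrable_on {x..y}" "(\<lambda>s. w (s, t)) integrable_on {x..y}" for s t x y
    by (auto intro!: integrable_continuous_interval wc)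
  have h: "flux_defect w g c1 c2 a a' b b' =
      flux_defect w g c1 c2 a m b b' + flux_defect w g c1 c2 m a' b b'"
    if "a \<le> m" "m \<le> a'" for a m a' b b'
    using integral_cbox_split_fst[OF g that, of b b']
      Henstock_Kurzweil_Integration.integral_combine[OF that i(2)[of b'], symmetric] Henstock_Kurzweil_Integration.integral_combine[OF that i(2)[of b], symmetric]
    by (simp add: flux_defect_def Henstock_Kurzweil_Integration.integral_diff i algebra_simps)
  have v: "flux_defect w g c1 c2 a a' b b' =
      flux_defect w g c1 c2 a a' b n + flux_defect w g c1 c2 a a' n b'"
    if "b \<le> n" "n \<le> b'" for a a' b n b'
    using integral_cbox_split_snd[OF g that, of a a']
      Henstock_Kurzweil_Integration.integral_combine[OF that i(1)[of a'], symmetric] Henstock_Kurzweil_Integration.integral_combine[OF that i(1)[of a], symmetric]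
    by (simp add: flux_defect_def Henstock_Kurzweil_Integration.integral_diff i algebra_simps)
  show ?thesis
    using v[OF assms(5,6), of a a'] h[OF assms(3,4), of b n] h[OF assms(3,4), of n b'] by simp
qed

text \<open>On a small square around a point of differentiability the affine part of \<open>w\<close> contributes
  nothing, so the defect is of smaller order than the area.\<close>
lemma flux_defect_small:
  fixes w g :: "real \<times> real \<Rightarrow> complex"
  assumes w: "continuous_on UNIV w" and g: "continuous_on UNIV g"
    and D: "(w has_derivative D) (at x)" and gx: "g x = c1 * D (1, 0) + c2 * D (0, 1)"
    and "e > 0"
  obtains d where "d > 0"
    "\<And>a b l. 0 \<le> l \<Longrightarrow> l < d \<Longrightarrow> x \<in> cbox (a, b) (a + l, b + l) \<Longrightarrow>
      norm (flux_defect w g c1 c2 a (a + l) b (b + l)) \<le> e * l\<^sup>2"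
proof -
  \<comment> \<open>\<open>K\<close> collects the final error terms: \<open>4 * \<eta> * l^2\<close>
    for each pair of opposite edges, weighted by \<open>norm c1\<close> or \<open>norm c2\<close>,
    and \<open>\<eta> * l^2\<close> for the area integral.\<close>
  define K where "K = 4 * norm c1 + 4 * norm c2 + 1"
  have K: "K > 0" unfolding K_def by (intro add_nonneg_pos add_nonneg_nonneg mult_nonneg_nonneg) auto
  define \<eta> where "\<eta> = e / K"
  have \<eta>: "\<eta> > 0" using K \<open>e > 0\<close> by (simp add: \<eta>_def)
  obtain d1 where d1: "d1 > 0" "\<And>y. norm (y - x) < d1 \<Longrightarrow> norm (w y - w x - D (y - x)) \<le> \<eta> * norm (y - x)"
    using D \<eta> unfolding has_derivative_within_alt by (auto)
  obtain d2 where d2: "d2 > 0" "\<And>y. dist y x < d2 \<Longrightarrow> dist (g y) (g x) < \<eta>"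
    using g \<eta> by (metis UNIV_I continuous_on_iff)
  interpret bounded_linear D using D by (rule has_derivative_bounded_linear)
  define r where "r y = w y - w x - D (y - x)" for y
  have wc: "continuous_on A (\<lambda>t. w (s, t))" "continuous_on A (\<lambda>s. w (s, t))" for s t A
    by (rule continuous_on_compose2[OF w]; force intro!: continuous_intros)+
  have i: "(\<lambda>t. w (s, t)) integrable_on {x..y}" "(\<lambda>s. w (s, t)) integrable_on {x..y}" for s t x y
    by (auto intro!: integrable_continuous_interval wc)
  show ?thesis
  \<comment> \<open>Halved because points of a square of side \<open>l\<close> are estimated to lie
    within \<open>2 * l\<close> of \<open>x\<close>.\<close>
  proof (rule that[of "min d1 d2 / 2"])
    show "min d1 d2 / 2 > 0" using d1 d2 by simp
    fix a b l :: real
    assume l: "0 \<le> l" "l < min d1 d2 / 2" and x: "x \<in> cbox (a, b) (a + l, b + l)"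
    have nx: "norm (y - x) \<le> 2 * l" if "y \<in> cbox (a, b) (a + l, b + l)" for y
    proof -
      have "norm (y - x) \<le> norm (fst (y - x)) + norm (snd (y - x))"
        by (metis norm_Pair_le surjective_pairing)
      also have "\<dots> \<le> 2 * l" using that x by (cases x; cases y) (auto simp: cbox_Pair_eq)
      finally show ?thesis .
    qed
    have r: "norm (r y) \<le> \<eta> * (2 * l)" if "y \<in> cbox (a, b) (a + l, b + l)" for y
    proof -
      have "norm (r y) \<le> \<eta> * norm (y - x)" unfolding r_def using nx[OF that] l by (intro d1) linarith
      also have "\<dots> \<le> \<eta> * (2 * l)" using nx[OF that] \<eta> by simp
      finally show ?thesis .
    qed
    have bnd: "norm (integral {p..p+l} (\<lambda>t. F t) - l * C) \<le> 4 * \<eta> * l\<^sup>2"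
      if F: "F integrable_on {p..p+l}"
        and "\<And>t. t \<in> {p..p+l} \<Longrightarrow> norm (F t - C) \<le> 4 * \<eta> * l" for F :: "real \<Rightarrow> complex" and p and C :: complex
    proof -
      have "integral {p..p+l} F - l * C = integral (cbox p (p+l)) (\<lambda>t. F t - C)"
        using l Henstock_Kurzweil_Integration.integral_diff[OF F integrable_const_ivl, of C]
        by (simp add: scaleR_conv_of_real)
      also have "norm \<dots> \<le> (4 * \<eta> * l) * measure lborel (cbox p (p+l))"
        by (rule integrable_bound) (use that l \<eta> in \<open>auto intro!: integrable_diff\<close>)
      finally show ?thesis using l by (simp add: power2_eq_square mult_ac)
    qed
    \<comment> \<open>Opposite edges differ by a fixed translation, so the linear part contributes
      the constant \<open>l * D (1, 0)\<close> and only the remainders \<open>r\<close> are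
      left.\<close>
    have D1: "w (a + l, t) - w (a, t) - l * D (1, 0) = r (a + l, t) - r (a, t)" for t
    proof -
      have "D ((a + l, t) - x) - D ((a, t) - x) = D (l *\<^sub>R (1, 0))"
        by (simp flip: diff)
      also have "\<dots> = l * D (1, 0)" by (simp only: scaleR scaleR_conv_of_real)
      finally show ?thesis by (simp add: r_def algebra_simps)
    qed
    have D2: "w (s, b + l) - w (s, b) - l * D (0, 1) = r (s, b + l) - r (s, b)" for s
    proof -
      have "D ((s, b + l) - x) - D ((s, b) - x) = D (l *\<^sub>R (0, 1))"
        by (simp flip: diff)
      also have "\<dots> = l * D (0, 1)" by (simp only: scaleR scaleR_conv_of_real)
      finally show ?thesis by (simp add: r_def algebra_simps)
    qed
    define I1 where "I1 = integral {b..b+l} (\<lambda>t. w (a + l, t) - w (a, t))"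
    define I2 where "I2 = integral {a..a+l} (\<lambda>s. w (s, b + l) - w (s, b))"
    define I3 where "I3 = integral (cbox (a, b) (a + l, b + l)) g"
    have 1: "norm (I1 - l * (l * D (1, 0))) \<le> 4 * \<eta> * l\<^sup>2"
      unfolding I1_def
    proof (rule bnd)
      fix t assume "t \<in> {b..b+l}"
      then have "norm (r (a + l, t)) \<le> \<eta> * (2 * l)" "norm (r (a, t)) \<le> \<eta> * (2 * l)"
        using l by (auto intro!: r simp: cbox_Pair_eq)
      then show "norm (w (a + l, t) - w (a, t) - l * D (1, 0)) \<le> 4 * \<eta> * l"
        unfolding D1 using norm_triangle_ineq4[of "r (a + l, t)" "r (a, t)"] by linarith
    qed (auto intro!: integrable_diff i)
    have 2: "norm (I2 - l * (l * D (0, 1))) \<le> 4 * \<eta> * l\<^sup>2"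
      unfolding I2_def
    proof (rule bnd)
      fix s assume "s \<in> {a..a+l}"
      then have "norm (r (s, b + l)) \<le> \<eta> * (2 * l)" "norm (r (s, b)) \<le> \<eta> * (2 * l)"
        using l by (auto intro!: r simp: cbox_Pair_eq)
      then show "norm (w (s, b + l) - w (s, b) - l * D (0, 1)) \<le> 4 * \<eta> * l"
        unfolding D2 using norm_triangle_ineq4[of "r (s, b + l)" "r (s, b)"] by linarith
    qed (auto intro!: integrable_diff i)
    have ct: "measure lborel (cbox (a, b) (a + l, b + l)) = l\<^sup>2"
      using l by (simp add: content_Pair power2_eq_square)
    have gi: "g integrable_on cbox (a, b) (a + l, b + l)"
      by (rule integrable_continuous) (rule continuous_on_subset[OF g], simp)
    have 3: "norm (I3 - l * l * g x) \<le> \<eta> * l\<^sup>2"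
    proof -
      have "I3 - l * l * g x = integral (cbox (a, b) (a + l, b + l)) (\<lambda>y. g y - g x)"
        using Henstock_Kurzweil_Integration.integral_diff[OF gi integrable_const, of "g x"]
        by (simp add: I3_def ct scaleR_conv_of_real power2_eq_square)
      also have "norm \<dots> \<le> \<eta> * measure lborel (cbox (a, b) (a + l, b + l))"
      proof (rule integrable_bound)
        fix y assume "y \<in> cbox (a, b) (a + l, b + l)"
        then have "dist y x < d2" using nx[of y] l by (simp add: dist_norm)
        then show "norm (g y - g x) \<le> \<eta>" using d2(2) by (simp add: dist_norm less_imp_le)
      qed (use \<eta> gi in \<open>auto intro!: integrable_diff\<close>)
      finally show ?thesis by (simp add: ct)
    qed
    have "flux_defect w g c1 c2 a (a + l) b (b + l) =
      c1 * (I1 - l * (l * D (1, 0))) + c2 * (I2 - l * (l * D (0, 1))) - (I3 - l * l * g x)"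
      by (simp add: flux_defect_def I1_def I2_def I3_def gx algebra_simps)
    also have "norm \<dots> \<le> norm c1 * (4 * \<eta> * l\<^sup>2) + norm c2 * (4 * \<eta> * l\<^sup>2) + \<eta> * l\<^sup>2"
    proof -
      have "norm (c1 * (I1 - l * (l * D (1, 0)))) \<le> norm c1 * (4 * \<eta> * l\<^sup>2)"
        "norm (c2 * (I2 - l * (l * D (0, 1)))) \<le> norm c2 * (4 * \<eta> * l\<^sup>2)"
        unfolding norm_mult by (intro mult_left_mono 1 2 norm_ge_zero)+
      with 3 show ?thesis
        using norm_triangle_ineq4[of "c1 * (I1 - l * (l * D (1, 0))) + c2 * (I2 - l * (l * D (0, 1)))" "I3 - l * l * g x"]
          norm_triangle_ineq[of "c1 * (I1 - l * (l * D (1, 0)))" "c2 * (I2 - l * (l * D (0, 1)))"]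
        by linarith
    qed
    also have "\<dots> = \<eta> * K * l\<^sup>2" by (simp add: K_def algebra_simps)
    also have "\<dots> = e * l\<^sup>2" using K by (simp add: \<eta>_def)
    finally show "norm (flux_defect w g c1 c2 a (a + l) b (b + l)) \<le> e * l\<^sup>2" .
  qed
qed

text \<open>Goursat's bisection argument: no continuity of the individual partial derivatives is assumed.\<close>
theorem flux_defect_eq_0:
  fixes w g :: "real \<times> real \<Rightarrow> complex"
  assumes D: "\<And>x. (w has_derivative D x) (at x)" and g: "continuous_on UNIV g"
    and gD: "\<And>x. g x = c1 * D x (1, 0) + c2 * D x (0, 1)"
  shows "flux_defect w g c1 c2 0 1 0 1 = 0"
proof (rule ccontr)
  assume nz: "\<not> ?thesis"
  have w: "continuous_on UNIV w"
    using D by (meson continuous_at_imp_continuous_on has_derivative_continuous)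
  define \<epsilon> where "\<epsilon> = norm (flux_defect w g c1 c2 0 1 0 1)"
  have \<epsilon>: "\<epsilon> > 0" using nz by (simp add: \<epsilon>_def)
  define l where "l n = (1 / 2 ^ n :: real)" for n
  have l: "l n > 0" "l (Suc n) = l n / 2" for n by (auto simp: l_def)
  \<comment> \<open>A square is bad if its defect is at least \<epsilon> times its area. By
    additivity a bad square has a bad quarter, since four good quarters would add up to a good
    square.\<close>
  define bad where "bad n p \<longleftrightarrow>
    \<epsilon> * (l n)\<^sup>2 \<le> norm (flux_defect w g c1 c2 (fst p) (fst p + l n) (snd p) (snd p + l n))"
    for n and p :: "real \<times> real"
  have step: "\<exists>q. bad (Suc n) q \<and> fst p \<le> fst q \<and> fst q \<le> fst p + l (Suc n) \<and>
      snd p \<le> snd q \<and> snd q \<le> snd p + l (Suc n)" if "bad n p" for n p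
  proof (rule ccontr)
    assume no: "\<not> ?thesis"
    obtain a b where p: "p = (a, b)" by (cases p)
    define k where "k = l (Suc n)"
    have ln: "l n = k + k" and k: "k > 0" using l[of n] by (auto simp: k_def)
    have lt: "norm (flux_defect w g c1 c2 a' (a' + k) b' (b' + k)) < \<epsilon> * k\<^sup>2"
      if "a' \<in> {a, a + k}" "b' \<in> {b, b + k}" for a' b'
    proof -
      have "\<not> (bad (Suc n) (a', b') \<and> a \<le> a' \<and> a' \<le> a + k \<and> b \<le> b' \<and> b' \<le> b + k)"
        using no unfolding p k_def by (metis fst_conv snd_conv)
      then have "\<not> bad (Suc n) (a', b')" using that k by auto
      then show ?thesis by (simp add: bad_def k_def not_le)
    qed
    have "\<epsilon> * (k + k)\<^sup>2 \<le> norm (flux_defect w g c1 c2 a (a + k + k) b (b + k + k))"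
      using that by (simp add: bad_def p ln add_ac)
    also have "\<dots> \<le> norm (flux_defect w g c1 c2 a (a + k) b (b + k)) +
      norm (flux_defect w g c1 c2 (a + k) (a + k + k) b (b + k)) +
      norm (flux_defect w g c1 c2 a (a + k) (b + k) (b + k + k)) +
      norm (flux_defect w g c1 c2 (a + k) (a + k + k) (b + k) (b + k + k))"
    proof -
      have tri: "norm (x1 + x2 + x3 + x4) \<le> norm x1 + norm x2 + norm x3 + norm x4" for x1 x2 x3 x4 :: complex
        using norm_triangle_ineq[of "x1 + x2 + x3" x4] norm_triangle_ineq[of "x1 + x2" x3]
          norm_triangle_ineq[of x1 x2] by linarith
      show ?thesis
        by (subst flux_defect_split[OF w g, of a "a + k" _ b "b + k"]) (use k in simp_all, rule tri)
    qed
    also have "\<dots> < \<epsilon> * k\<^sup>2 + \<epsilon> * k\<^sup>2 + \<epsilon> * k\<^sup>2 + \<epsilon> * k\<^sup>2"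
      by (intro add_strict_mono lt) auto
    finally show False by (simp add: power2_eq_square algebra_simps)
  qed
  obtain p where p: "\<And>n. bad n (p n)" and pn: "\<And>n. fst (p n) \<le> fst (p (Suc n)) \<and>
      fst (p (Suc n)) \<le> fst (p n) + l (Suc n) \<and>
      snd (p n) \<le> snd (p (Suc n)) \<and> snd (p (Suc n)) \<le> snd (p n) + l (Suc n)"
  proof -
    have "\<exists>p. \<forall>n. bad n (p n) \<and> fst (p n) \<le> fst (p (Suc n)) \<and>
      fst (p (Suc n)) \<le> fst (p n) + l (Suc n) \<and>
      snd (p n) \<le> snd (p (Suc n)) \<and> snd (p (Suc n)) \<le> snd (p n) + l (Suc n)"
    proof (rule dependent_nat_choice)
      show "\<exists>x. bad 0 x" by (rule exI[of _ "(0, 0)"]) (simp add: bad_def l_def \<epsilon>_def)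
    qed (rule step)
    then show ?thesis using that by blast
  qed
  have l0: "l \<longlonglongrightarrow> 0"
    unfolding l_def using LIMSEQ_divide_realpow_zero[of 2 1] by simp
  have nested: "\<exists>x. \<forall>n. u n \<le> x \<and> x \<le> u n + l n"
    if "\<And>n. u n \<le> u (Suc n) \<and> u (Suc n) \<le> u n + l (Suc n)" for u
  proof -
    have "\<exists>x. ((\<forall>n. u n \<le> x) \<and> u \<longlonglongrightarrow> x) \<and>
        ((\<forall>n. x \<le> u n + l n) \<and> (\<lambda>n. u n + l n) \<longlonglongrightarrow> x)"
    proof (rule nested_sequence_unique)
      show "\<forall>n. u n \<le> u (Suc n)" using that by blast
      show "\<forall>n. u (Suc n) + l (Suc n) \<le> u n + l n"
      proof
        fix n show "u (Suc n) + l (Suc n) \<le> u n + l n" using that[of n] l(2)[of n] by linarith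
      qed
      show "\<forall>n. u n \<le> u n + l n" using l(1) by (simp add: less_imp_le)
      show "(\<lambda>n. u n - (u n + l n)) \<longlonglongrightarrow> 0" using tendsto_minus[OF l0] by simp
    qed
    then show ?thesis by blast
  qed
  obtain x1 where x1: "\<And>n. fst (p n) \<le> x1 \<and> x1 \<le> fst (p n) + l n"
    using nested[of "\<lambda>n. fst (p n)"] pn by blast
  obtain x2 where x2: "\<And>n. snd (p n) \<le> x2 \<and> x2 \<le> snd (p n) + l n"
    using nested[of "\<lambda>n. snd (p n)"] pn by blast
  \<comment> \<open>At the common point of the nested bad squares the local estimate is taken with
    half the constant, which contradicts badness once the side is below \<open>d\<close>.\<close>
  obtain d where d: "d > 0" "\<And>a b l. 0 \<le> l \<Longrightarrow> l < d \<Longrightarrow> (x1, x2) \<in> cbox (a, b) (a + l, b + l) \<Longrightarrow>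
      norm (flux_defect w g c1 c2 a (a + l) b (b + l)) \<le> (\<epsilon> / 2) * l\<^sup>2"
    by (rule flux_defect_small[OF w g D gD half_gt_zero[OF \<epsilon>]]) blast
  obtain n where "l n < d" using order_tendstoD(2)[OF l0 d(1)] by (auto simp: eventually_sequentially)
  then have "norm (flux_defect w g c1 c2 (fst (p n)) (fst (p n) + l n) (snd (p n)) (snd (p n) + l n))
     \<le> (\<epsilon> / 2) * (l n)\<^sup>2"
    using l(1)[of n] x1[of n] x2[of n] by (intro d) (auto simp: mem_box Basis_prod_def inner_prod_def)
  with p[of n] have "\<epsilon> * (l n)\<^sup>2 \<le> (\<epsilon> / 2) * (l n)\<^sup>2" by (simp add: bad_def)
  then show False using \<epsilon> l(1)[of n] by simp
qed

text \<open>Periodicity makes the values on opposite sides agree, so both flux terms vanish. Stating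
  it for a fixed combination \<open>g\<close> of partial derivatives lets a single Wirtinger
  derivative be integrated.\<close>

corollary integral_unit_square_derivative_eq_0:
  fixes w g :: "real \<times> real \<Rightarrow> complex"
  assumes "\<And>x. (w has_derivative D x) (at x)" and "continuous_on UNIV g"
    and "\<And>x. g x = c1 * D x (1, 0) + c2 * D x (0, 1)"
    and "\<And>s t. w (s + 1, t) = w (s, t)" "\<And>s t. w (s, t + 1) = w (s, t)"
  shows "integral (cbox (0, 0) (1, 1)) g = 0"
  using flux_defect_eq_0[OF assms(1-3)] assms(4)[of 0] assms(5)[of _ 0] by (simp add: flux_defect_def)

section \<open>Fourier coefficients of lattice-periodic functions\<close>

text \<open>On this exponential the operators d/dz and d/dcnj z act as multiplication by
  \<open>pi * \<i> * x\<close> and \<open>pi * \<i> * y\<close>. The parameters are independent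
  complex numbers because multipliers need not be unitary; \<open>y = cnj x\<close> is the unitary
  case.\<close>

definition echar :: "complex \<Rightarrow> complex \<Rightarrow> complex \<Rightarrow> complex" where
  "echar x y z = exp (of_real pi * \<i> * (x * z + y * cnj z))"

abbreviation fchar :: "complex \<Rightarrow> complex \<Rightarrow> complex" where
  "fchar \<delta> \<equiv> echar (cnj \<delta>) \<delta>"

lemma echar_mult: "echar x y z * echar x' y' z = echar (x + x') (y + y') z"
  by (simp add: echar_def algebra_simps flip: exp_add)

lemma echar_add: "echar x y (z + z') = echar x y z * echar x y z'"
  by (simp add: echar_def algebra_simps flip: exp_add)

lemma echar_0 [simp]: "echar 0 0 z = 1" "echar x y 0 = 1"
  by (simp_all add: echar_def)

lemma echar_nonzero [simp]: "echar x y z \<noteq> 0"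
  by (simp add: echar_def)

lemma echar_minus: "echar (- x) (- y) z = inverse (echar x y z)"
  by (simp add: echar_def algebra_simps flip: exp_minus)

lemma fchar_eq_exp: "fchar \<delta> z = exp (2 * of_real pi * \<i> * of_real (inner \<delta> z))"
proof -
  have "cnj \<delta> * z + \<delta> * cnj z = 2 * of_real (inner \<delta> z)"
    by (simp add: complex_eq_iff inner_complex_def)
  then show ?thesis by (simp add: echar_def mult_ac)
qed

lemma fchar_eq_cis: "fchar \<delta> z = cis (2 * pi * inner \<delta> z)"
  by (simp add: fchar_eq_exp cis_conv_exp mult_ac)

lemma fchar_minus: "fchar (- \<delta>) z = cnj (fchar \<delta> z)"
  using fchar_eq_cis[of "- \<delta>" z] by (simp add: fchar_eq_cis cis_cnj)

lemma echar_has_derivative: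
  "(echar x y has_derivative (\<lambda>v. echar x y z * (of_real pi * \<i> * (x * v + y * cnj v)))) (at z)"
proof -
  have "((\<lambda>z. of_real pi * \<i> * (x * z + y * cnj z)) has_derivative
      (\<lambda>v. of_real pi * \<i> * (x * v + y * cnj v))) (at z)"
    by (auto intro!: derivative_eq_intros bounded_linear.has_derivative[OF bounded_linear_cnj])
  then show ?thesis
    unfolding echar_def using has_derivative_compose[OF _ DERIV_exp[unfolded has_field_derivative_def]]
    by (fastforce simp: o_def)
qed

lemma continuous_on_echar [continuous_intros]:
  "continuous_on A f \<Longrightarrow> continuous_on A (\<lambda>z. echar x y (f z))"
  unfolding echar_def by (intro continuous_intros)

section \<open>Lattice coordinates and the dual basis\<close>

locale lattice_basis =
  fixes \<omega>1 \<omega>2 :: complex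
  assumes basis: "is_lattice_basis \<omega>1 \<omega>2"
begin

abbreviation \<Gamma> :: "complex set" where "\<Gamma> \<equiv> lattice \<omega>1 \<omega>2"

abbreviation \<Gamma>d :: "complex set" where "\<Gamma>d \<equiv> dual_lattice \<Gamma>"

definition covol :: real where "covol = Im (cnj \<omega>1 * \<omega>2)"

lemma covol_nonzero [simp]: "covol \<noteq> 0"
  using basis by (simp add: covol_def is_lattice_basis_def)

definition lin :: "real \<times> real \<Rightarrow> complex" where
  "lin x = of_real (fst x) * \<omega>1 + of_real (snd x) * \<omega>2"

text \<open>\<open>dual1\<close> and \<open>dual2\<close> form the basis dual to the periods: a
  quarter turn makes a period orthogonal to itself, and dividing by the signed \<open>covol\<close>
  normalises the pairing with the other period for either orientation.\<close>

definition dual1 :: complex where "dual1 = - \<i> * \<omega>2 / of_real covol"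

definition dual2 :: complex where "dual2 = \<i> * \<omega>1 / of_real covol"

lemma inner_dual_lin: "inner dual1 (lin x) = fst x" "inner dual2 (lin x) = snd x"
proof -
  have c: "covol = Re \<omega>1 * Im \<omega>2 - Im \<omega>1 * Re \<omega>2"
    by (simp add: covol_def)
  have "covol * inner dual1 (lin x) = covol * fst x" "covol * inner dual2 (lin x) = covol * snd x"
    by (simp_all add: dual1_def dual2_def lin_def inner_complex_def field_simps)
       (simp_all add: c algebra_simps)
  then show "inner dual1 (lin x) = fst x" "inner dual2 (lin x) = snd x" by simp_all
qed

lemma lin_inner_dual: "lin (inner dual1 z, inner dual2 z) = z"
proof -
  have c: "covol = Re \<omega>1 * Im \<omega>2 - Im \<omega>1 * Re \<omega>2"
    by (simp add: covol_def)
  have "of_real covol * lin (inner dual1 z, inner dual2 z) = of_real covol * z"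
    by (simp add: complex_eq_iff dual1_def dual2_def lin_def inner_complex_def field_simps)
       (simp add: c algebra_simps)
  then show ?thesis by simp
qed

lemma lin_add: "lin (x + y) = lin x + lin y"
  by (simp add: lin_def algebra_simps)

lemma lin_int_in_lattice: "lin (of_int m, of_int n) \<in> \<Gamma>"
  by (auto simp: lin_def lattice_def)

lemma lattice_eq_lin: "\<Gamma> = {lin (of_int m, of_int n) | m n. True}"
  by (auto simp: lin_def lattice_def)

lemma basis_in_lattice: "\<omega>1 \<in> \<Gamma>" "\<omega>2 \<in> \<Gamma>"
  using lin_int_in_lattice[of 1 0] lin_int_in_lattice[of 0 1] by (simp_all add: lin_def)

lemma dual_in: "dual1 \<in> \<Gamma>d" "dual2 \<in> \<Gamma>d"
  by (auto simp: dual_lattice_def lattice_eq_lin inner_dual_lin)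

lemma dual_lattice_add: "\<delta> \<in> \<Gamma>d \<Longrightarrow> \<delta>' \<in> \<Gamma>d \<Longrightarrow> \<delta> + \<delta>' \<in> \<Gamma>d"
  by (auto simp: dual_lattice_def inner_add_left)

lemma dual_lattice_uminus: "\<delta> \<in> \<Gamma>d \<Longrightarrow> - \<delta> \<in> \<Gamma>d"
  by (auto simp: dual_lattice_def)

lemma dual_lattice_0: "0 \<in> \<Gamma>d"
  by (auto simp: dual_lattice_def)

lemma dual_expansion: "v = of_real (inner v \<omega>1) * dual1 + of_real (inner v \<omega>2) * dual2"
proof -
  have "inner (v - (of_real (inner v \<omega>1) * dual1 + of_real (inner v \<omega>2) * dual2)) (lin x) = 0" for x
  proof -
    have e: "inner (of_real k * d) z = k * inner d z" for k and d z :: complex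
      by (simp add: inner_complex_def algebra_simps)
    have "inner v (lin x) = fst x * inner v \<omega>1 + snd x * inner v \<omega>2"
      by (simp add: lin_def inner_add_right inner_complex_def algebra_simps)
    then show ?thesis unfolding inner_diff_left inner_add_left e inner_dual_lin by (simp add: mult_ac)
  qed
  then have "inner (v - (of_real (inner v \<omega>1) * dual1 + of_real (inner v \<omega>2) * dual2)) z = 0" for z
    by (metis lin_inner_dual)
  then show ?thesis by (metis eq_iff_diff_eq_0 inner_eq_zero_iff)
qed

text \<open>A dual vector is determined by its two integer pairings with the periods, and the
  Cauchy-Schwarz inequality bounds these on a ball.\<close>

lemma finite_dual_lattice_cball: "finite (\<Gamma>d \<inter> cball 0 R)"
proof -
  define M where "M = \<lceil>\<bar>R\<bar> * (norm \<omega>1 + norm \<omega>2)\<rceil>"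
  have "\<Gamma>d \<inter> cball 0 R \<subseteq> (\<lambda>(m, n). of_int m * dual1 + of_int n * dual2) ` ({-M..M} \<times> {-M..M})"
  proof
    fix \<delta> assume \<delta>: "\<delta> \<in> \<Gamma>d \<inter> cball 0 R"
    then have "inner \<delta> \<omega>1 \<in> \<int>" "inner \<delta> \<omega>2 \<in> \<int>"
      using basis_in_lattice by (auto simp: dual_lattice_def)
    then obtain m n where mn: "inner \<delta> \<omega>1 = of_int m" "inner \<delta> \<omega>2 = of_int n"
      by (metis Ints_cases)
    have "\<bar>inner \<delta> \<omega>\<bar> \<le> \<bar>R\<bar> * (norm \<omega>1 + norm \<omega>2)" if "\<omega> = \<omega>1 \<or> \<omega> = \<omega>2" for \<omega>
    proof -
      have "\<bar>inner \<delta> \<omega>\<bar> \<le> norm \<delta> * norm \<omega>" by (rule Cauchy_Schwarz_ineq2)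
      also have "\<dots> \<le> \<bar>R\<bar> * (norm \<omega>1 + norm \<omega>2)" using \<delta> that by (intro mult_mono) auto
      finally show ?thesis .
    qed
    then have "\<bar>m\<bar> \<le> M" "\<bar>n\<bar> \<le> M"
      using mn unfolding M_def by (metis (full_types) ceiling_mono ceiling_of_int of_int_abs)+
    moreover have "\<delta> = of_int m * dual1 + of_int n * dual2"
      using dual_expansion[of \<delta>] mn by simp
    ultimately show "\<delta> \<in> (\<lambda>(m, n). of_int m * dual1 + of_int n * dual2) ` ({-M..M} \<times> {-M..M})"
      by (intro image_eqI[of _ _ "(m, n)"]) auto
  qed
  then show ?thesis by (rule finite_subset) auto
qed

section \<open>Periodic functions and their means over a period parallelogram\<close>

definition periodic :: "(complex \<Rightarrow> complex) \<Rightarrow> bool" where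
  "periodic \<phi> \<longleftrightarrow> (\<forall>z. \<forall>\<gamma>\<in>\<Gamma>. \<phi> (z + \<gamma>) = \<phi> z)"

lemma fchar_lattice: "\<delta> \<in> \<Gamma>d \<Longrightarrow> \<gamma> \<in> \<Gamma> \<Longrightarrow> fchar \<delta> \<gamma> = 1"
  by (auto simp: dual_lattice_def fchar_eq_cis elim!: ballE[of _ _ \<gamma>] Ints_cases intro!: cis_multiple_2pi)

lemma periodic_fchar: "\<delta> \<in> \<Gamma>d \<Longrightarrow> periodic (fchar \<delta>)"
  by (simp add: periodic_def echar_add fchar_lattice)

text \<open>Integrating in lattice coordinates omits the Jacobian, so the constant 1 has mean
  1.\<close>

definition mean :: "(complex \<Rightarrow> complex) \<Rightarrow> complex" where
  "mean \<phi> = integral (cbox (0, 0) (1, 1)) (\<lambda>x. \<phi> (lin x))"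

lemma continuous_on_lin [continuous_intros]: "continuous_on A lin"
  unfolding lin_def by (intro continuous_intros)

lemma mean_integrable:
  fixes \<phi> :: "complex \<Rightarrow> complex"
  assumes "continuous_on UNIV \<phi>"
  shows "(\<lambda>x. \<phi> (lin x)) integrable_on cbox (0, 0) (1, 1)"
proof (rule integrable_continuous)
  show "continuous_on (cbox (0, 0) (1, 1)) (\<lambda>x. \<phi> (lin x))"
    by (rule continuous_on_compose2[OF assms continuous_on_lin]) auto
qed

lemma mean_add:
  "continuous_on UNIV \<phi> \<Longrightarrow> continuous_on UNIV \<psi> \<Longrightarrow> mean (\<lambda>z. \<phi> z + \<psi> z) = mean \<phi> + mean \<psi>"
  unfolding mean_def by (intro Henstock_Kurzweil_Integration.integral_add mean_integrable)

lemma mean_diff: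
  "continuous_on UNIV \<phi> \<Longrightarrow> continuous_on UNIV \<psi> \<Longrightarrow> mean (\<lambda>z. \<phi> z - \<psi> z) = mean \<phi> - mean \<psi>"
  unfolding mean_def by (intro Henstock_Kurzweil_Integration.integral_diff mean_integrable)

lemma mean_cmult: "mean (\<lambda>z. c * \<phi> z) = c * mean \<phi>"
  unfolding mean_def by simp

lemma mean_0 [simp]: "mean (\<lambda>z. 0) = 0"
  by (simp add: mean_def)

lemma mean_sum:
  "finite S \<Longrightarrow> (\<And>i. i \<in> S \<Longrightarrow> continuous_on UNIV (\<phi> i)) \<Longrightarrow>
    mean (\<lambda>z. \<Sum>i\<in>S. \<phi> i z) = (\<Sum>i\<in>S. mean (\<phi> i))"
  by (induction S rule: finite_induct) (auto simp: mean_add continuous_on_sum)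

lemma mean_derivative_eq_0:
  assumes "periodic \<phi>" and D: "\<And>z. (\<phi> has_derivative D z) (at z)"
    and g: "continuous_on UNIV g" and gD: "\<And>z. g z = c1 * D z \<omega>1 + c2 * D z \<omega>2"
  shows "mean g = 0"
  unfolding mean_def
proof (rule integral_unit_square_derivative_eq_0[where w = "\<lambda>x. \<phi> (lin x)"
      and D = "\<lambda>x v. D (lin x) (lin v)" and ?c1.0 = c1 and ?c2.0 = c2])
  show "((\<lambda>x. \<phi> (lin x)) has_derivative (\<lambda>v. D (lin x) (lin v))) (at x)" for x
  proof (rule has_derivative_compose[OF _ D])
    show "(lin has_derivative lin) (at x)"
      unfolding lin_def by (auto intro!: derivative_eq_intros)
  qed
  show "continuous_on UNIV (\<lambda>x. g (lin x))"
    by (rule continuous_on_compose2[OF g continuous_on_lin]) auto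
  show "g (lin x) = c1 * D (lin x) (lin (1, 0)) + c2 * D (lin x) (lin (0, 1))" for x
    by (simp add: gD) (simp add: lin_def)
  have "\<phi> (lin ((s, t) + (1, 0))) = \<phi> (lin (s, t))" "\<phi> (lin ((s, t) + (0, 1))) = \<phi> (lin (s, t))" for s t
    using assms(1) basis_in_lattice unfolding lin_add periodic_def by (simp_all add: lin_def)
  then show "\<phi> (lin (s + 1, t)) = \<phi> (lin (s, t))" "\<phi> (lin (s, t + 1)) = \<phi> (lin (s, t))" for s t
    by simp_all
qed

text \<open>The derivatives along the two periods are
  \<open>A z * \<omega> + B z * cnj \<omega>\<close>. Cramer's rule recovers \<open>A\<close> and
  \<open>B\<close> as constant combinations of them; the determinant is a nonzero multiple of
  \<open>covol\<close>.\<close>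

lemma
  assumes "periodic \<phi>" and D: "\<And>z. (\<phi> has_derivative (\<lambda>v. A z * v + B z * cnj v)) (at z)"
  shows mean_dz_eq_0: "continuous_on UNIV A \<Longrightarrow> mean A = 0"
    and mean_dzbar_eq_0: "continuous_on UNIV B \<Longrightarrow> mean B = 0"
proof -
  have nz: "\<omega>1 * cnj \<omega>2 - \<omega>2 * cnj \<omega>1 \<noteq> 0"
    using covol_nonzero by (auto simp: complex_eq_iff covol_def)
  have nz': "cnj \<omega>1 * \<omega>2 - cnj \<omega>2 * \<omega>1 \<noteq> 0" using nz by (auto simp: mult_ac)
  show "mean A = 0" if "continuous_on UNIV A"
    by (rule mean_derivative_eq_0[OF assms that, where ?c1.0 = "cnj \<omega>2 / (\<omega>1 * cnj \<omega>2 - \<omega>2 * cnj \<omega>1)"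
         and ?c2.0 = "- cnj \<omega>1 / (\<omega>1 * cnj \<omega>2 - \<omega>2 * cnj \<omega>1)"])
       (use nz in \<open>simp add: divide_simps\<close>, simp add: algebra_simps)
  show "mean B = 0" if "continuous_on UNIV B"
    by (rule mean_derivative_eq_0[OF assms that, where ?c1.0 = "\<omega>2 / (cnj \<omega>1 * \<omega>2 - cnj \<omega>2 * \<omega>1)"
         and ?c2.0 = "- \<omega>1 / (cnj \<omega>1 * \<omega>2 - cnj \<omega>2 * \<omega>1)"])
       (use nz' in \<open>simp add: divide_simps\<close>, simp add: algebra_simps)
qed

text \<open>A character of nonzero frequency is a nonzero multiple of its own z-derivative, so its
  mean vanishes.\<close>

lemma mean_fchar:
  assumes "\<delta> \<in> \<Gamma>d"
  shows "mean (fchar \<delta>) = (if \<delta> = 0 then 1 else 0)"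
proof (cases "\<delta> = 0")
  case True
  then show ?thesis by (simp add: mean_def content_Pair)
next
  case False
  have "mean (\<lambda>z. (of_real pi * \<i> * cnj \<delta>) * fchar \<delta> z) = 0"
    by (rule mean_dz_eq_0[OF periodic_fchar[OF assms], where B = "\<lambda>z. (of_real pi * \<i> * \<delta>) * fchar \<delta> z"])
       (auto intro!: continuous_intros has_derivative_eq_rhs[OF echar_has_derivative] simp: algebra_simps)
  with False show ?thesis by (simp add: mean_cmult)
qed

text \<open>The two basic characters embed the torus in the plane \<open>C^2\<close>; periodic
  functions become functions on a compact set, where the Stone-Weierstrass theorem applies.\<close>

definition tor :: "complex \<Rightarrow> complex \<times> complex" where
  "tor z = (fchar dual1 z, fchar dual2 z)"

lemma continuous_on_tor [continuous_intros]: "continuous_on A tor"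
  unfolding tor_def by (intro continuous_intros)

definition fourier_null :: "(complex \<Rightarrow> complex) \<Rightarrow> bool" where
  "fourier_null \<phi> \<longleftrightarrow> continuous_on UNIV \<phi> \<and> (\<forall>\<delta>\<in>\<Gamma>d. mean (\<lambda>z. \<phi> z * fchar \<delta> z) = 0)"

lemma fourier_null_add:
  "fourier_null \<phi> \<Longrightarrow> fourier_null \<psi> \<Longrightarrow> fourier_null (\<lambda>z. \<phi> z + \<psi> z)"
  by (auto simp: fourier_null_def distrib_right intro!: continuous_intros)
     (subst mean_add; auto intro!: continuous_intros)

lemma fourier_null_cmult: "fourier_null \<phi> \<Longrightarrow> fourier_null (\<lambda>z. c * \<phi> z)"
  by (auto simp: fourier_null_def mult.assoc mean_cmult intro!: continuous_intros)

lemma fourier_null_fchar: "fourier_null \<phi> \<Longrightarrow> \<delta> \<in> \<Gamma>d \<Longrightarrow> fourier_null (\<lambda>z. fchar \<delta> z * \<phi> z)"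
proof -
  assume \<phi>: "fourier_null \<phi>" and \<delta>: "\<delta> \<in> \<Gamma>d"
  have "mean (\<lambda>z. fchar \<delta> z * \<phi> z * fchar \<delta>' z) = 0" if "\<delta>' \<in> \<Gamma>d" for \<delta>'
  proof -
    have "fchar \<delta> z * \<phi> z * fchar \<delta>' z = \<phi> z * fchar (\<delta> + \<delta>') z" for z
      by (simp add: mult.assoc mult.left_commute[of _ "\<phi> z"] echar_mult)
    then have "(\<lambda>z. fchar \<delta> z * \<phi> z * fchar \<delta>' z) = (\<lambda>z. \<phi> z * fchar (\<delta> + \<delta>') z)" by (rule ext)
    then show ?thesis using \<phi> dual_lattice_add[OF \<delta> that] by (simp only: fourier_null_def)
  qed
  with \<phi> show ?thesis by (auto simp: fourier_null_def intro!: continuous_intros)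
qed

lemma fourier_null_Re_Im:
  assumes "fourier_null \<phi>" "\<delta> \<in> \<Gamma>d"
  shows "fourier_null (\<lambda>z. of_real (Re (fchar \<delta> z)) * \<phi> z)"
    and "fourier_null (\<lambda>z. of_real (Im (fchar \<delta> z)) * \<phi> z)"
proof -
  have re: "of_real (Re w) = 1 / 2 * w + 1 / 2 * cnj w" and im: "of_real (Im w) = - \<i> / 2 * w + \<i> / 2 * cnj w" for w
    by (simp_all add: complex_eq_iff)
  have n: "fourier_null (\<lambda>z. c * (fchar \<delta> z * \<phi> z) + d * (fchar (-\<delta>) z * \<phi> z))" for c d
    by (intro fourier_null_add fourier_null_cmult fourier_null_fchar assms dual_lattice_uminus)
  show "fourier_null (\<lambda>z. of_real (Re (fchar \<delta> z)) * \<phi> z)"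
    using n[of "1 / 2" "1 / 2"] unfolding fchar_minus re distrib_right mult.assoc .
  show "fourier_null (\<lambda>z. of_real (Im (fchar \<delta> z)) * \<phi> z)"
    using n[of "- \<i> / 2" "\<i> / 2"] unfolding fchar_minus im distrib_right mult.assoc .
qed

text \<open>Multiplication by a character only permutes Fourier coefficients, so the functions with
  vanishing coefficients form a module over the real polynomials in the real and imaginary parts of
  the basic characters.\<close>

lemma fourier_null_polynomial:
  assumes "real_polynomial_function p" "fourier_null \<phi>"
  shows "fourier_null (\<lambda>z. of_real (p (tor z)) * \<phi> z)"
  using assms
proof (induction arbitrary: \<phi> rule: real_polynomial_function.induct)
  case (linear f)
  interpret bounded_linear f by fact
  have *: "f w = f ((1, 0)) * Re (fst w) + f ((\<i>, 0)) * Im (fst w) + f ((0, 1)) * Re (snd w) + f ((0, \<i>)) * Im (snd w)" for w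
  proof -
    have "w = Re (fst w) *\<^sub>R (1, 0) + Im (fst w) *\<^sub>R (\<i>, 0) + Re (snd w) *\<^sub>R (0, 1) + Im (snd w) *\<^sub>R (0, \<i>)"
      by (cases w) (simp add: complex_eq_iff)
    then have "f w = f \<dots>" by (rule arg_cong)
    then show ?thesis by (simp only: add scaleR real_scaleR_def mult.commute)
  qed
  have "(\<lambda>z. of_real (f (tor z)) * \<phi> z) =
     (\<lambda>z. of_real (f ((1, 0))) * (of_real (Re (fchar dual1 z)) * \<phi> z)
        + of_real (f ((\<i>, 0))) * (of_real (Im (fchar dual1 z)) * \<phi> z)
        + of_real (f ((0, 1))) * (of_real (Re (fchar dual2 z)) * \<phi> z)
        + of_real (f ((0, \<i>))) * (of_real (Im (fchar dual2 z)) * \<phi> z))"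
    by (subst *) (simp only: tor_def fst_conv snd_conv of_real_add of_real_mult distrib_right mult.assoc)
  then show ?case
    using \<open>fourier_null \<phi>\<close> by (auto intro!: fourier_null_add fourier_null_cmult fourier_null_Re_Im dual_in)
next
  case (const c)
  then show ?case by (intro fourier_null_cmult)
next
  case (add f g)
  then show ?case by (auto simp: distrib_right intro!: fourier_null_add)
next
  case (mult f g)
  \<comment> \<open>The factor \<open>g\<close> is first absorbed into the null function, which is
    why the induction leaves \<phi> arbitrary.\<close>
  show ?case using mult.IH(1)[OF mult.IH(2)[OF mult.prems]] by (simp add: mult.assoc)
qed

lemma lattice_reduce: obtains x \<gamma> where "x \<in> cbox (0, 0) (1, 1)" "\<gamma> \<in> \<Gamma>" "z = lin x + \<gamma>"
proof -
  define s t where "s = inner dual1 z" and "t = inner dual2 z"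
  have "z = lin (frac s, frac t) + lin (of_int \<lfloor>s\<rfloor>, of_int \<lfloor>t\<rfloor>)"
    by (simp add: s_def t_def frac_def lin_inner_dual flip: lin_add)
  moreover have "(frac s, frac t) \<in> cbox (0, 0) (1, 1)"
    by (auto simp: cbox_Pair_eq frac_lt_1 less_imp_le)
  ultimately show ?thesis using that lin_int_in_lattice by blast
qed

lemma tor_eq_imp:
  assumes "tor z = tor z'"
  shows "z - z' \<in> \<Gamma>"
proof -
  have *: "\<exists>n::int. inner \<delta> (z - z') = of_int n" if "fchar \<delta> z = fchar \<delta> z'" for \<delta>
  proof -
    have "fchar \<delta> (z - z') = 1" using that echar_add[of "cnj \<delta>" \<delta> "z - z'" z'] by simp
    then have "cos (2 * pi * inner \<delta> (z - z')) = 1" by (simp add: fchar_eq_cis complex_eq_iff)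
    then obtain n where "2 * pi * inner \<delta> (z - z') = of_int n * 2 * pi"
      using cos_one_2pi_int by blast
    then show ?thesis by (intro exI[of _ n]) auto
  qed
  obtain m n where "inner dual1 (z - z') = of_int m" "inner dual2 (z - z') = of_int n"
    using assms * unfolding tor_def by (metis prod.inject)
  then show ?thesis
    using lin_inner_dual[of "z - z'"] lin_int_in_lattice[of m n] by simp
qed

text \<open>Points with equal image under \<open>tor\<close> differ by a lattice vector, so the
  choice of preimage in \<open>G\<close> does not matter. Continuity follows because
  \<open>tor\<close> maps closed subsets of the compact parallelogram to compact, hence closed,
  sets.\<close>

lemma continuous_factor_tor:
  fixes \<phi> :: "complex \<Rightarrow> complex"
  assumes \<phi>: "continuous_on UNIV \<phi>" "periodic \<phi>"
  obtains G where "continuous_on (tor ` lin ` cbox (0, 0) (1, 1)) G"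
    "\<And>z. z \<in> lin ` cbox (0, 0) (1, 1) \<Longrightarrow> G (tor z) = \<phi> z"
proof -
  define Q where "Q = lin ` cbox (0, 0) (1, 1)"
  define G where "G y = \<phi> (SOME z. z \<in> Q \<and> tor z = y)" for y
  have G: "G (tor z) = \<phi> z" if "z \<in> Q" for z
  proof -
    have "(SOME z'. z' \<in> Q \<and> tor z' = tor z) \<in> Q \<and> tor (SOME z'. z' \<in> Q \<and> tor z' = tor z) = tor z"
      by (rule someI_ex) (use that in blast)
    then have "(SOME z'. z' \<in> Q \<and> tor z' = tor z) - z \<in> \<Gamma>" by (intro tor_eq_imp) auto
    then show ?thesis using \<phi>(2) unfolding G_def periodic_def by (metis add_diff_cancel_left' diff_add_cancel add.commute)
  qed
  have Q: "compact Q" unfolding Q_def by (intro compact_continuous_image continuous_intros compact_cbox)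
  have "closedin (top_of_set (tor ` Q)) (tor ` Q \<inter> G -` C)" if "closed C" for C
  proof -
    have "tor ` Q \<inter> G -` C = tor ` (Q \<inter> \<phi> -` C)" using G by auto
    moreover have "compact (Q \<inter> \<phi> -` C)"
      by (intro compact_Int_closed Q closed_vimage continuous_on_subset[OF \<phi>(1)] that) auto
    then have "compact (tor ` (Q \<inter> \<phi> -` C))"
      by (intro compact_continuous_image continuous_intros)
    ultimately show ?thesis by (metis closed_subset compact_imp_closed inf_le1)
  qed
  then have "continuous_on (tor ` Q) G"
    by (simp add: continuous_on_closed_vimage continuous_closedin_preimage_eq)
  with G show ?thesis using that unfolding Q_def by blast
qed

text \<open>A periodic function descends to the torus, where its conjugate is a uniform limit of polynomials
  in the characters; a function without Fourier coefficients is orthogonal to all of these.\<close>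
theorem fourier_unique:
  assumes \<phi>: "continuous_on UNIV \<phi>" "periodic \<phi>"
    and 0: "\<And>\<delta>. \<delta> \<in> \<Gamma>d \<Longrightarrow> mean (\<lambda>z. \<phi> z * fchar \<delta> z) = 0"
  shows "\<phi> z = 0"
proof -
  define Q where "Q = cbox (0::real, 0::real) (1, 1)"
  have null: "fourier_null \<phi>" using assms by (simp add: fourier_null_def)
  have \<phi>': "continuous_on UNIV (\<lambda>z. cnj (\<phi> z))" "periodic (\<lambda>z. cnj (\<phi> z))"
    using \<phi> by (auto simp: periodic_def intro!: continuous_intros)
  obtain G where G: "continuous_on (tor ` lin ` Q) G" "\<And>z. z \<in> lin ` Q \<Longrightarrow> G (tor z) = cnj (\<phi> z)"
    using continuous_factor_tor[OF \<phi>'] unfolding Q_def by blast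
  have cmp: "compact (lin ` Q)" "compact (tor ` lin ` Q)"
    unfolding Q_def by (intro compact_continuous_image continuous_intros compact_cbox)+
  have "bounded (\<phi> ` lin ` Q)"
    by (intro compact_imp_bounded compact_continuous_image cmp continuous_on_subset[OF \<phi>(1)]) auto
  then obtain B where B: "B > 0" "\<And>z. z \<in> lin ` Q \<Longrightarrow> norm (\<phi> z) \<le> B"
    by (metis bounded_pos imageI)
  have int0: "mean (\<lambda>z. \<phi> z * cnj (\<phi> z)) = 0"
  proof (rule ccontr)
    assume nz: "\<not> ?thesis"
    \<comment> \<open>With this tolerance the error bound \<open>B * e\<close> is half the norm that
      is supposed to be nonzero.\<close>
    define e where "e = norm (mean (\<lambda>z. \<phi> z * cnj (\<phi> z))) / (2 * B)"
    have e: "e > 0" using nz B by (simp add: e_def)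
    obtain g where g: "polynomial_function g" "\<And>y. y \<in> tor ` lin ` Q \<Longrightarrow> norm (G y - g y) < e"
      using Stone_Weierstrass_polynomial_function[OF cmp(2) G(1) e] by blast
    have gc: "continuous_on A g" for A by (rule continuous_on_polymonial_function[OF g(1)])
    have rp: "real_polynomial_function (Re \<circ> g)" "real_polynomial_function (Im \<circ> g)"
      using g(1) bounded_linear_Re bounded_linear_Im unfolding polynomial_function_def by blast+
    have "fourier_null (\<lambda>z. of_real ((Re \<circ> g) (tor z)) * \<phi> z + \<i> * (of_real ((Im \<circ> g) (tor z)) * \<phi> z))"
      by (intro fourier_null_add fourier_null_cmult fourier_null_polynomial rp null)
    moreover have "of_real ((Re \<circ> g) (tor z)) * \<phi> z + \<i> * (of_real ((Im \<circ> g) (tor z)) * \<phi> z) = \<phi> z * g (tor z)" for z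
      by (simp add: complex_eq_iff)
    ultimately have "fourier_null (\<lambda>z. \<phi> z * g (tor z))" by simp
    then have g0: "mean (\<lambda>z. \<phi> z * g (tor z)) = 0"
      unfolding fourier_null_def using dual_lattice_0 by fastforce
    have c: "continuous_on UNIV (\<lambda>z. \<phi> z * g (tor z))"
      by (intro continuous_intros \<phi> continuous_on_compose2[OF gc continuous_on_tor]) auto
    have "mean (\<lambda>z. \<phi> z * cnj (\<phi> z)) = mean (\<lambda>z. \<phi> z * cnj (\<phi> z) - \<phi> z * g (tor z))"
      using g0 by (subst mean_diff) (auto intro!: continuous_intros \<phi> c)
    also have "norm \<dots> \<le> (B * e) * measure lborel (cbox (0::real, 0::real) (1, 1))"
      unfolding mean_def
    proof (rule integrable_bound)
      show "(\<lambda>x. \<phi> (lin x) * cnj (\<phi> (lin x)) - \<phi> (lin x) * g (tor (lin x))) integrable_on cbox (0, 0) (1, 1)"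
        by (rule mean_integrable) (intro continuous_intros \<phi> c)
      fix x :: "real \<times> real" assume "x \<in> cbox (0, 0) (1, 1)"
      then have x: "lin x \<in> lin ` Q" by (simp add: Q_def)
      have "norm (\<phi> (lin x) * (G (tor (lin x)) - g (tor (lin x)))) \<le> B * e"
        unfolding norm_mult using x B e less_imp_le[OF g(2)] by (intro mult_mono) auto
      then show "norm (\<phi> (lin x) * cnj (\<phi> (lin x)) - \<phi> (lin x) * g (tor (lin x))) \<le> B * e"
        using G(2)[OF x] by (simp add: algebra_simps)
    qed (use B e in simp)
    finally have "norm (mean (\<lambda>z. \<phi> z * cnj (\<phi> z))) \<le> B * e" by (simp add: content_Pair)
    also have "B * e = norm (mean (\<lambda>z. \<phi> z * cnj (\<phi> z))) / 2" using B by (simp add: e_def)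
    finally show False using nz by simp
  qed
  have cl: "continuous_on Q (\<lambda>x. \<phi> (lin x))"
    by (rule continuous_on_compose2[OF \<phi>(1) continuous_on_lin]) auto
  have "integral Q (\<lambda>x. (norm (\<phi> (lin x)))\<^sup>2) = 0"
  proof -
    have "((\<lambda>x. (norm (\<phi> (lin x)))\<^sup>2) has_integral integral Q (\<lambda>x. (norm (\<phi> (lin x)))\<^sup>2)) Q"
      unfolding Q_def by (intro integrable_integral integrable_continuous continuous_intros cl[unfolded Q_def])
    then have "((\<lambda>x. complex_of_real ((norm (\<phi> (lin x)))\<^sup>2)) has_integral
        of_real (integral Q (\<lambda>x. (norm (\<phi> (lin x)))\<^sup>2))) Q"
      by (rule has_integral_of_real)
    then have "of_real (integral Q (\<lambda>x. (norm (\<phi> (lin x)))\<^sup>2)) = mean (\<lambda>z. \<phi> z * cnj (\<phi> z))"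
      unfolding mean_def complex_norm_square Q_def by (simp add: integral_unique)
    with int0 show ?thesis by simp
  qed
  moreover have "box (0::real, 0::real) (1, 1) \<noteq> {}"
  proof -
    have "(1/2, 1/2) \<in> box (0::real, 0::real) (1, 1)" by (simp add: box_def Basis_prod_def inner_prod_def)
    then show ?thesis by blast
  qed
  moreover have "continuous_on Q (\<lambda>x. (norm (\<phi> (lin x)))\<^sup>2)" by (intro continuous_intros cl)
  ultimately have "\<forall>x\<in>Q. (norm (\<phi> (lin x)))\<^sup>2 = 0"
    unfolding Q_def by (subst (asm) integral_cbox_eq_0_iff) simp_all
  then have z0: "\<phi> (lin x) = 0" if "x \<in> Q" for x using that by simp
  obtain x \<gamma> where "x \<in> Q" "\<gamma> \<in> \<Gamma>" "z = lin x + \<gamma>" using lattice_reduce unfolding Q_def by blast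
  with z0 \<phi>(2) show ?thesis by (simp add: periodic_def)
qed

end

section \<open>The Dirac equation of a holomorphic section\<close>

lemma rscale_Pair: "rscale (a, b) c = (a * c, b * c)"
  by (simp add: rscale_def qmul_def qofc_def)

lemma rscale_eq: "rscale q c = (fst q * c, snd q * c)"
  by (cases q) (simp add: rscale_Pair)

locale hs_lattice = lattice_basis +
  fixes \<beta>0 :: complex
  assumes \<beta>0_nonzero: "\<beta>0 \<noteq> 0" and \<beta>0_dual: "\<beta>0 \<in> \<Gamma>d"
begin

text \<open>This is \<open>holomorphic_q\<close> without continuity of the derivative, the level at
  which membership of the torus can be checked directly and at which the Fourier analysis is carried
  out.\<close>

definition weak_hol :: "(complex \<Rightarrow> quat) \<Rightarrow> bool" where
  "weak_hol \<alpha> \<longleftrightarrow> (\<exists>D. (\<forall>z. (\<alpha> has_derivative D z) (at z)) \<and>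
      (\<forall>z v. D z (\<i> * v) = qmul (normalN \<beta>0 z) (D z v)))"

definition sections :: "(complex \<Rightarrow> complex) \<Rightarrow> (complex \<Rightarrow> quat) set" where
  "sections h = {\<alpha>. weak_hol \<alpha> \<and> (\<forall>z. \<forall>\<gamma>\<in>\<Gamma>. \<alpha> (z + \<gamma>) = rscale (\<alpha> z) (h \<gamma>))}"

lemma H0_subset_sections: "H0 \<Gamma> \<beta>0 h \<subseteq> sections h"
  unfolding H0_def sections_def holomorphic_q_def weak_hol_def by blast

definition spU :: "(complex \<Rightarrow> quat) \<Rightarrow> complex \<Rightarrow> complex" where
  "spU \<alpha> z = fchar (- (\<beta>0 / 2)) z * (fst (\<alpha> z) + \<i> * snd (\<alpha> z))
             - fchar (\<beta>0 / 2) z * (fst (\<alpha> z) - \<i> * snd (\<alpha> z))"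

definition spV :: "(complex \<Rightarrow> quat) \<Rightarrow> complex \<Rightarrow> complex" where
  "spV \<alpha> z = fchar (- (\<beta>0 / 2)) z * (fst (\<alpha> z) + \<i> * snd (\<alpha> z))
             + fchar (\<beta>0 / 2) z * (fst (\<alpha> z) - \<i> * snd (\<alpha> z))"

lemma fchar_half: "fchar (\<beta>0 / 2) z * fchar (- (\<beta>0 / 2)) z = 1"
  "fchar (\<beta>0 / 2) z * fchar (\<beta>0 / 2) z = cis (betaf \<beta>0 z)"
  by (simp_all add: echar_mult) (simp add: fchar_eq_cis betaf_def)

lemma fst_eq_sp: "fst (\<alpha> z) = (fchar (\<beta>0 / 2) z * (spU \<alpha> z + spV \<alpha> z) + fchar (- (\<beta>0 / 2)) z * (spV \<alpha> z - spU \<alpha> z)) / 4"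
  and snd_eq_sp: "snd (\<alpha> z) = - \<i> * (fchar (\<beta>0 / 2) z * (spU \<alpha> z + spV \<alpha> z) - fchar (- (\<beta>0 / 2)) z * (spV \<alpha> z - spU \<alpha> z)) / 4"
proof -
  define e e' a b where "e = fchar (\<beta>0 / 2) z" "e' = fchar (- (\<beta>0 / 2)) z" "a = fst (\<alpha> z)" "b = snd (\<alpha> z)"
  have ee: "e * e' = 1" using fchar_half(1) by (simp add: e_e'_a_b_def)
  have 1: "e * (spU \<alpha> z + spV \<alpha> z) = 2 * (a + \<i> * b)"
  proof -
    have "e * (spU \<alpha> z + spV \<alpha> z) = 2 * (e * e') * (a + \<i> * b)"
      unfolding spU_def spV_def e_e'_a_b_def by algebra
    then show ?thesis using ee by simp
  qed
  have 2: "e' * (spV \<alpha> z - spU \<alpha> z) = 2 * (a - \<i> * b)"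
  proof -
    have "e' * (spV \<alpha> z - spU \<alpha> z) = 2 * (e * e') * (a - \<i> * b)"
      unfolding spU_def spV_def e_e'_a_b_def by algebra
    then show ?thesis using ee by simp
  qed
  show "fst (\<alpha> z) = (fchar (\<beta>0 / 2) z * (spU \<alpha> z + spV \<alpha> z) + fchar (- (\<beta>0 / 2)) z * (spV \<alpha> z - spU \<alpha> z)) / 4"
    "snd (\<alpha> z) = - \<i> * (fchar (\<beta>0 / 2) z * (spU \<alpha> z + spV \<alpha> z) - fchar (- (\<beta>0 / 2)) z * (spV \<alpha> z - spU \<alpha> z)) / 4"
    unfolding e_e'_a_b_def[symmetric] 1 2 by (simp_all add: field_simps)
qed

lemma spU_lincomb:
  "spU (\<lambda>z. \<Sum>k<n. rscale (a k z) (c k)) z = (\<Sum>k<(n::nat). c k * spU (a k) z)"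
proof (induction n)
  case (Suc n)
  then show ?case by (simp add: spU_def rscale_eq algebra_simps)
qed (simp add: spU_def)

lemma spV_lincomb:
  "spV (\<lambda>z. \<Sum>k<n. rscale (a k z) (c k)) z = (\<Sum>k<(n::nat). c k * spV (a k) z)"
proof (induction n)
  case (Suc n)
  then show ?case by (simp add: spV_def rscale_eq algebra_simps)
qed (simp add: spV_def)

lemma weak_hol_continuous:
  assumes "weak_hol \<alpha>"
  shows "continuous_on UNIV (spU \<alpha>)" "continuous_on UNIV (spV \<alpha>)"
proof -
  have "continuous_on UNIV \<alpha>"
    using assms unfolding weak_hol_def
    by (meson continuous_at_imp_continuous_on has_derivative_continuous)
  then show "continuous_on UNIV (spU \<alpha>)" "continuous_on UNIV (spV \<alpha>)"
    unfolding spU_def[abs_def] spV_def[abs_def] by (auto intro!: continuous_intros)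
qed

text \<open>After the rotation by half-angle phases the derivative of \<open>V\<close> would be
  complex linear and that of \<open>U\<close> antilinear; the product rule on the phases adds a
  multiple of the other component. \<open>A\<close> and \<open>B\<close> are the uncontrolled
  Wirtinger coefficients.\<close>

lemma dirac:
  assumes "weak_hol \<alpha>"
  obtains A B where
    "\<And>z. (spU \<alpha> has_derivative (\<lambda>v. (- (\<i> * pi * cnj \<beta>0 / 2) * spV \<alpha> z) * v + B z * cnj v)) (at z)"
    "\<And>z. (spV \<alpha> has_derivative (\<lambda>v. A z * v + (- (\<i> * pi * \<beta>0 / 2) * spU \<alpha> z) * cnj v)) (at z)"
proof -
  obtain D where D: "\<And>z. (\<alpha> has_derivative D z) (at z)"
    and N: "\<And>z v. D z (\<i> * v) = qmul (normalN \<beta>0 z) (D z v)"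
    using assms unfolding weak_hol_def by blast
  define e e' where "e z = fchar (\<beta>0 / 2) z" and "e' z = fchar (- (\<beta>0 / 2)) z" for z
  have ee: "e z * e' z = 1" "e' z * e z = 1" for z using fchar_half(1)[of z] by (simp_all add: e_def e'_def mult.commute)
  define Dp where "Dp z v = fst (D z v) + \<i> * snd (D z v)" for z v
  define Dq where "Dq z v = fst (D z v) - \<i> * snd (D z v)" for z v
  have Dpi: "Dp z (\<i> * v) = \<i> * (e z * e z) * Dq z v" for z v
    unfolding Dp_def Dq_def N e_def fchar_half(2)
    by (simp add: qmul_def normalN_def expj_def qofc_def complex_eq_iff algebra_simps)
  have Dqi: "Dq z (\<i> * v) = \<i> * (e' z * e' z) * Dp z v" for z v
  proof -
    have "e' z = cnj (e z)" unfolding e_def e'_def by (rule fchar_minus)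
    then have "e' z * e' z = cnj (cis (betaf \<beta>0 z))" by (simp add: e_def flip: fchar_half(2))
    then have e2: "e' z * e' z = cis (- betaf \<beta>0 z)" by (simp add: cis_cnj)
    show ?thesis
      unfolding Dp_def Dq_def N e2
      by (simp add: qmul_def normalN_def expj_def qofc_def complex_eq_iff algebra_simps)
  qed
  have lin: "D z v = Re v *\<^sub>R D z 1 + Im v *\<^sub>R D z \<i>" for z v
  proof -
    interpret bounded_linear "D z" using D by (rule has_derivative_bounded_linear)
    have "v = Re v *\<^sub>R 1 + Im v *\<^sub>R \<i>" by (simp add: complex_eq_iff)
    then have "D z v = D z \<dots>" by (rule arg_cong)
    then show ?thesis by (simp only: add scaleR)
  qed
  have re: "of_real (Re v) = (v + cnj v) / 2" and im: "of_real (Im v) * \<i> = (v - cnj v) / 2" for v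
    by (simp_all add: complex_eq_iff)
  have Dp: "Dp z v = (Dp z 1 + e z * e z * Dq z 1) / 2 * v + (Dp z 1 - e z * e z * Dq z 1) / 2 * cnj v" for z v
  proof -
    have "Dp z v = of_real (Re v) * Dp z 1 + of_real (Im v) * Dp z \<i>"
      unfolding Dp_def by (subst (1 2) lin[of z v]) (simp add: scaleR_conv_of_real algebra_simps)
    also have "\<dots> = (v + cnj v) / 2 * Dp z 1 + (of_real (Im v) * \<i>) * (e z * e z) * Dq z 1"
      using Dpi[of z 1] by (simp add: re)
    finally show ?thesis unfolding im by (simp add: field_simps)
  qed
  have Dq: "Dq z v = (Dq z 1 + e' z * e' z * Dp z 1) / 2 * v + (Dq z 1 - e' z * e' z * Dp z 1) / 2 * cnj v" for z v
  proof -
    have "Dq z v = of_real (Re v) * Dq z 1 + of_real (Im v) * Dq z \<i>"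
      unfolding Dq_def by (subst (1 2) lin[of z v]) (simp add: scaleR_conv_of_real algebra_simps)
    also have "\<dots> = (v + cnj v) / 2 * Dq z 1 + (of_real (Im v) * \<i>) * (e' z * e' z) * Dp z 1"
      using Dqi[of z 1] by (simp add: re)
    finally show ?thesis unfolding im by (simp add: field_simps)
  qed
  \<comment> \<open>Distributing the phase evenly, \<open>e'\<close> on one component and
    \<open>e\<close> on the other, expresses both derivatives by the same two numbers, called
    \<open>P\<close> and \<open>Q\<close> below: the normal has become constant.\<close>
  have eDp: "e' z * Dp z v = (e' z * Dp z 1 + e z * Dq z 1) / 2 * v + (e' z * Dp z 1 - e z * Dq z 1) / 2 * cnj v" for z v
  proof -
    have "e' z * Dp z v = (e' z * Dp z 1 + (e' z * e z) * e z * Dq z 1) / 2 * v + (e' z * Dp z 1 - (e' z * e z) * e z * Dq z 1) / 2 * cnj v"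
      by (subst Dp) (simp add: field_simps)
    then show ?thesis by (simp add: ee)
  qed
  have eDq: "e z * Dq z v = (e z * Dq z 1 + e' z * Dp z 1) / 2 * v + (e z * Dq z 1 - e' z * Dp z 1) / 2 * cnj v" for z v
  proof -
    have "e z * Dq z v = (e z * Dq z 1 + (e z * e' z) * e' z * Dp z 1) / 2 * v + (e z * Dq z 1 - (e z * e' z) * e' z * Dp z 1) / 2 * cnj v"
      by (subst Dq) (simp add: field_simps)
    then show ?thesis by (simp add: ee)
  qed
  define B where "B z = (e' z * Dp z 1 - e z * Dq z 1) - \<i> * pi * \<beta>0 / 2 * spV \<alpha> z" for z
  define A where "A z = (e' z * Dp z 1 + e z * Dq z 1) - \<i> * pi * cnj \<beta>0 / 2 * spU \<alpha> z" for z
  have pd: "((\<lambda>z. fst (\<alpha> z) + \<i> * snd (\<alpha> z)) has_derivative Dp z) (at z)" for z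
    unfolding Dp_def[abs_def] by (auto intro!: derivative_eq_intros D has_derivative_fst has_derivative_snd)
  have qd: "((\<lambda>z. fst (\<alpha> z) - \<i> * snd (\<alpha> z)) has_derivative Dq z) (at z)" for z
    unfolding Dq_def[abs_def] by (auto intro!: derivative_eq_intros D has_derivative_fst has_derivative_snd)
  have ed: "(e has_derivative (\<lambda>v. e z * (of_real pi * \<i> * (cnj \<beta>0 / 2 * v + \<beta>0 / 2 * cnj v)))) (at z)"
    "(e' has_derivative (\<lambda>v. - e' z * (of_real pi * \<i> * (cnj \<beta>0 / 2 * v + \<beta>0 / 2 * cnj v)))) (at z)" for z
    unfolding e_def[abs_def] e'_def[abs_def]
    by (rule has_derivative_eq_rhs[OF echar_has_derivative]; simp add: fun_eq_iff algebra_simps)+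
  show ?thesis
  proof (rule that[where A = A and B = B])
    fix z
    have U: "spU \<alpha> = (\<lambda>z. e' z * (fst (\<alpha> z) + \<i> * snd (\<alpha> z)) - e z * (fst (\<alpha> z) - \<i> * snd (\<alpha> z)))"
      and V: "spV \<alpha> = (\<lambda>z. e' z * (fst (\<alpha> z) + \<i> * snd (\<alpha> z)) + e z * (fst (\<alpha> z) - \<i> * snd (\<alpha> z)))"
      by (simp_all add: fun_eq_iff spU_def spV_def e_def e'_def)
    define P Q where "P = e' z * Dp z 1" and "Q = e z * Dq z 1"
    have eD: "e' z * Dp z v = (P + Q) / 2 * v + (P - Q) / 2 * cnj v"
      "e z * Dq z v = (Q + P) / 2 * v + (Q - P) / 2 * cnj v" for v
      unfolding P_def Q_def by (rule eDp eDq)+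
    have AB: "A z = (P + Q) - \<i> * pi * cnj \<beta>0 / 2 * spU \<alpha> z" "B z = (P - Q) - \<i> * pi * \<beta>0 / 2 * spV \<alpha> z"
      by (simp_all add: A_def B_def P_def Q_def)
    show "(spU \<alpha> has_derivative (\<lambda>v. (- (\<i> * pi * cnj \<beta>0 / 2) * spV \<alpha> z) * v + B z * cnj v)) (at z)"
    proof (subst U, rule has_derivative_eq_rhs[OF has_derivative_diff[OF has_derivative_mult[OF ed(2) pd] has_derivative_mult[OF ed(1) qd]]], rule ext)
      fix v
      show "e' z * Dp z v + - e' z * (of_real pi * \<i> * (cnj \<beta>0 / 2 * v + \<beta>0 / 2 * cnj v)) * (fst (\<alpha> z) + \<i> * snd (\<alpha> z)) -
         (e z * Dq z v + e z * (of_real pi * \<i> * (cnj \<beta>0 / 2 * v + \<beta>0 / 2 * cnj v)) * (fst (\<alpha> z) - \<i> * snd (\<alpha> z)))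
         = (- (\<i> * pi * cnj \<beta>0 / 2) * spV \<alpha> z) * v + B z * cnj v"
        unfolding eD AB V by (simp add: field_simps)
    qed
    show "(spV \<alpha> has_derivative (\<lambda>v. A z * v + (- (\<i> * pi * \<beta>0 / 2) * spU \<alpha> z) * cnj v)) (at z)"
    proof (subst V, rule has_derivative_eq_rhs[OF has_derivative_add[OF has_derivative_mult[OF ed(2) pd] has_derivative_mult[OF ed(1) qd]]], rule ext)
      fix v
      show "e' z * Dp z v + - e' z * (of_real pi * \<i> * (cnj \<beta>0 / 2 * v + \<beta>0 / 2 * cnj v)) * (fst (\<alpha> z) + \<i> * snd (\<alpha> z)) +
         (e z * Dq z v + e z * (of_real pi * \<i> * (cnj \<beta>0 / 2 * v + \<beta>0 / 2 * cnj v)) * (fst (\<alpha> z) - \<i> * snd (\<alpha> z)))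
         = A z * v + (- (\<i> * pi * \<beta>0 / 2) * spU \<alpha> z) * cnj v"
        unfolding eD AB U by (simp add: field_simps)
    qed
  qed
qed

text \<open>Since \<open>\<beta>0 / 2\<close> need not be a dual vector, the half-angle phase
  changes by a sign under a period, and \<open>spU\<close>, \<open>spV\<close> acquire the
  multiplier \<open>h\<close> times this sign. A twist is a logarithm of that product; adding a dual
  vector gives another one.\<close>

definition twist :: "(complex \<Rightarrow> complex) \<Rightarrow> complex \<Rightarrow> complex \<Rightarrow> bool" where
  "twist h x y \<longleftrightarrow> (\<forall>\<gamma>\<in>\<Gamma>. echar x y \<gamma> = h \<gamma> * fchar (\<beta>0 / 2) \<gamma>)"

lemma twist_shift: "twist h x y \<Longrightarrow> \<delta> \<in> \<Gamma>d \<Longrightarrow> twist h (x + cnj \<delta>) (y + \<delta>)"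
  by (simp add: twist_def fchar_lattice flip: echar_mult)

lemma fchar_half_lattice: "\<gamma> \<in> \<Gamma> \<Longrightarrow> fchar (- (\<beta>0 / 2)) \<gamma> = fchar (\<beta>0 / 2) \<gamma>"
  "\<gamma> \<in> \<Gamma> \<Longrightarrow> fchar (\<beta>0 / 2) \<gamma> * fchar (\<beta>0 / 2) \<gamma> = 1"
proof -
  assume "\<gamma> \<in> \<Gamma>"
  then show *: "fchar (\<beta>0 / 2) \<gamma> * fchar (\<beta>0 / 2) \<gamma> = 1"
    using fchar_lattice[OF \<beta>0_dual] by (simp add: echar_mult)
  show "fchar (- (\<beta>0 / 2)) \<gamma> = fchar (\<beta>0 / 2) \<gamma>"
    using * fchar_half(1)[of \<gamma>] by (metis echar_nonzero mult_cancel_left)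
qed

lemma
  assumes "\<alpha> \<in> sections h" "twist h x y"
  shows periodic_spU: "periodic (\<lambda>z. spU \<alpha> z * echar (- x) (- y) z)"
    and periodic_spV: "periodic (\<lambda>z. spV \<alpha> z * echar (- x) (- y) z)"
proof -
  have *: "h \<gamma> * fchar (\<beta>0 / 2) \<gamma> * echar (- x) (- y) \<gamma> = 1" if "\<gamma> \<in> \<Gamma>" for \<gamma>
    using assms(2) that unfolding twist_def by (metis echar_minus echar_nonzero right_inverse)
  have "spU \<alpha> (z + \<gamma>) = h \<gamma> * fchar (\<beta>0 / 2) \<gamma> * spU \<alpha> z"
    "spV \<alpha> (z + \<gamma>) = h \<gamma> * fchar (\<beta>0 / 2) \<gamma> * spV \<alpha> z" if "\<gamma> \<in> \<Gamma>" for z \<gamma>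
  proof -
    have "\<alpha> (z + \<gamma>) = rscale (\<alpha> z) (h \<gamma>)" using assms(1) that by (simp add: sections_def)
    then show "spU \<alpha> (z + \<gamma>) = h \<gamma> * fchar (\<beta>0 / 2) \<gamma> * spU \<alpha> z"
      "spV \<alpha> (z + \<gamma>) = h \<gamma> * fchar (\<beta>0 / 2) \<gamma> * spV \<alpha> z"
      unfolding spU_def spV_def echar_add fchar_half_lattice(1)[OF that]
      by (simp_all only: rscale_eq fst_conv snd_conv ring_distribs mult_ac)
  qed
  then have "spU \<alpha> (z + \<gamma>) * echar (- x) (- y) (z + \<gamma>) =
      (h \<gamma> * fchar (\<beta>0 / 2) \<gamma> * echar (- x) (- y) \<gamma>) * (spU \<alpha> z * echar (- x) (- y) z)"
    "spV \<alpha> (z + \<gamma>) * echar (- x) (- y) (z + \<gamma>) =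
      (h \<gamma> * fchar (\<beta>0 / 2) \<gamma> * echar (- x) (- y) \<gamma>) * (spV \<alpha> z * echar (- x) (- y) z)"
    if "\<gamma> \<in> \<Gamma>" for z \<gamma>
    using that by (simp_all only: echar_add mult_ac)
  then show "periodic (\<lambda>z. spU \<alpha> z * echar (- x) (- y) z)" "periodic (\<lambda>z. spV \<alpha> z * echar (- x) (- y) z)"
    using * by (simp_all add: periodic_def)
qed

text \<open>Modes are indexed by the full exponent instead of a dual vector, so that one pair of
  equations covers all modes by \<open>twist_shift\<close>.\<close>

definition coefU :: "(complex \<Rightarrow> quat) \<Rightarrow> complex \<Rightarrow> complex \<Rightarrow> complex" where
  "coefU \<alpha> x y = mean (\<lambda>z. spU \<alpha> z * echar (- x) (- y) z)"

definition coefV :: "(complex \<Rightarrow> quat) \<Rightarrow> complex \<Rightarrow> complex \<Rightarrow> complex" where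
  "coefV \<alpha> x y = mean (\<lambda>z. spV \<alpha> z * echar (- x) (- y) z)"

text \<open>The z-derivative of \<open>spU \<alpha>\<close> times the inverse exponential has mean
  zero, and so has the conjugate derivative for \<open>spV \<alpha>\<close>. Each splits into a
  Dirac term and the derivative of the exponential.\<close>

lemma coef_equations:
  assumes \<alpha>: "\<alpha> \<in> sections h" "twist h x y"
  shows "cnj \<beta>0 / 2 * coefV \<alpha> x y + x * coefU \<alpha> x y = 0"
    and "\<beta>0 / 2 * coefU \<alpha> x y + y * coefV \<alpha> x y = 0"
proof -
  have wh: "weak_hol \<alpha>" using \<alpha>(1) by (simp add: sections_def)
  note c = weak_hol_continuous[OF wh]
  obtain A B where U: "\<And>z. (spU \<alpha> has_derivative (\<lambda>v. (- (\<i> * pi * cnj \<beta>0 / 2) * spV \<alpha> z) * v + B z * cnj v)) (at z)"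
    and V: "\<And>z. (spV \<alpha> has_derivative (\<lambda>v. A z * v + (- (\<i> * pi * \<beta>0 / 2) * spU \<alpha> z) * cnj v)) (at z)"
    by (rule dirac[OF wh]) (rule that)
  define E where "E = echar (- x) (- y)"
  have E: "(E has_derivative (\<lambda>v. E z * (of_real pi * \<i> * (- x * v + - y * cnj v)))) (at z)" for z
    unfolding E_def by (rule echar_has_derivative)
  have cE: "continuous_on UNIV E" unfolding E_def by (intro continuous_intros)
  \<comment> \<open>The uncontrolled coefficient \<open>B\<close> enters only the antilinear part of
    the derivative, whose continuity \<open>mean_dz_eq_0\<close> does not ask for.\<close>
  have "mean (\<lambda>z. (- (\<i> * pi * cnj \<beta>0 / 2)) * (spV \<alpha> z * E z) + (- (pi * \<i> * x)) * (spU \<alpha> z * E z)) = 0"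
    by (rule mean_dz_eq_0[OF periodic_spU[OF \<alpha>],
          where B = "\<lambda>z. B z * E z - pi * \<i> * y * (spU \<alpha> z * E z)"])
       (fold E_def, rule has_derivative_eq_rhs[OF has_derivative_mult[OF U E]],
        simp add: fun_eq_iff algebra_simps, intro continuous_intros c cE)
  then have "(- (\<i> * pi * cnj \<beta>0 / 2)) * coefV \<alpha> x y + (- (pi * \<i> * x)) * coefU \<alpha> x y = 0"
    unfolding coefU_def coefV_def E_def[symmetric] mean_cmult[symmetric]
    by (subst mean_add[symmetric]) (assumption | intro continuous_intros c cE)+
  then have "- (\<i> * pi) * (cnj \<beta>0 / 2 * coefV \<alpha> x y + x * coefU \<alpha> x y) = 0" by (simp add: algebra_simps)
  then show "cnj \<beta>0 / 2 * coefV \<alpha> x y + x * coefU \<alpha> x y = 0" by simp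
  have "mean (\<lambda>z. (- (\<i> * pi * \<beta>0 / 2)) * (spU \<alpha> z * E z) + (- (pi * \<i> * y)) * (spV \<alpha> z * E z)) = 0"
    by (rule mean_dzbar_eq_0[OF periodic_spV[OF \<alpha>],
          where A = "\<lambda>z. A z * E z - pi * \<i> * x * (spV \<alpha> z * E z)"])
       (fold E_def, rule has_derivative_eq_rhs[OF has_derivative_mult[OF V E]],
        simp add: fun_eq_iff algebra_simps, intro continuous_intros c cE)
  then have "(- (\<i> * pi * \<beta>0 / 2)) * coefU \<alpha> x y + (- (pi * \<i> * y)) * coefV \<alpha> x y = 0"
    unfolding coefU_def coefV_def E_def[symmetric] mean_cmult[symmetric]
    by (subst mean_add[symmetric]) (assumption | intro continuous_intros c cE)+
  then have "- (\<i> * pi) * (\<beta>0 / 2 * coefU \<alpha> x y + y * coefV \<alpha> x y) = 0" by (simp add: algebra_simps)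
  then show "\<beta>0 / 2 * coefU \<alpha> x y + y * coefV \<alpha> x y = 0" by simp
qed

lemma coefV_eq_0: "\<alpha> \<in> sections h \<Longrightarrow> twist h x y \<Longrightarrow> coefU \<alpha> x y = 0 \<Longrightarrow> coefV \<alpha> x y = 0"
  using coef_equations(1) \<beta>0_nonzero by fastforce

text \<open>The two mode equations form a linear system whose determinant vanishes exactly when
  \<open>x * y\<close> has the resonant value; \<open>coefV\<close> is eliminated.\<close>

lemma coefU_eq_0:
  assumes "\<alpha> \<in> sections h" "twist h x y" "x * y \<noteq> \<beta>0 * cnj \<beta>0 / 4"
  shows "coefU \<alpha> x y = 0"
proof -
  have "(\<beta>0 * cnj \<beta>0 / 4 - x * y) * coefU \<alpha> x y =
    cnj \<beta>0 / 2 * (\<beta>0 / 2 * coefU \<alpha> x y + y * coefV \<alpha> x y) -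
    y * (cnj \<beta>0 / 2 * coefV \<alpha> x y + x * coefU \<alpha> x y)"
    by (simp add: algebra_simps)
  also have "\<dots> = 0" using coef_equations[OF assms(1,2)] by simp
  finally show ?thesis using assms(3) by simp
qed

end

section \<open>Dimension bounds\<close>

lemma underdetermined_system:
  fixes \<phi> :: "'a \<Rightarrow> 'b \<Rightarrow> complex"
  assumes "finite K" "finite I" "card K < card I"
  shows "\<exists>c. (\<exists>i\<in>I. c i \<noteq> 0) \<and> (\<forall>k\<in>K. (\<Sum>i\<in>I. c i * \<phi> k i) = 0)"
  using assms
proof (induction K arbitrary: I \<phi> rule: finite_induct)
  case empty
  then have "I \<noteq> {}" by auto
  then show ?case by (intro exI[of _ "\<lambda>_. 1"]) auto
next
  case (insert k K)
  show ?case
  proof (cases "\<forall>i\<in>I. \<phi> k i = 0")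
    case True
    obtain c where "\<exists>i\<in>I. c i \<noteq> 0" "\<forall>k\<in>K. (\<Sum>i\<in>I. c i * \<phi> k i) = 0"
      using insert.IH[of I \<phi>] insert.prems insert.hyps by auto
    with True show ?thesis by (intro exI[of _ c]) auto
  next
    case False
    then obtain p where p: "p \<in> I" "\<phi> k p \<noteq> 0" by blast
    \<comment> \<open>Gaussian elimination: equation \<open>k\<close> is solved for the unknown
      \<open>p\<close> and substituted in the others. The value \<open>- s\<close> given to
      \<open>p\<close> below restores equation \<open>k\<close>.\<close>
    define \<psi> where "\<psi> k' i = \<phi> k' i - \<phi> k i / \<phi> k p * \<phi> k' p" for k' i
    have "card K < card (I - {p})" using insert p by auto
    then obtain c where c: "\<exists>i\<in>I - {p}. c i \<noteq> 0" "\<forall>k\<in>K. (\<Sum>i\<in>I - {p}. c i * \<psi> k i) = 0"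
      using insert.IH[of "I - {p}" \<psi>] insert.prems by auto
    define s where "s = (\<Sum>i\<in>I - {p}. c i * (\<phi> k i / \<phi> k p))"
    define d where "d i = (if i = p then - s else c i)" for i
    have sum: "(\<Sum>i\<in>I. d i * \<phi> k' i) = (\<Sum>i\<in>I - {p}. c i * \<phi> k' i) - s * \<phi> k' p" for k'
      using p insert.prems by (subst sum.remove[of I p]) (auto simp: d_def intro!: sum.cong)
    have "(\<Sum>i\<in>I. d i * \<phi> k' i) = 0" if "k' \<in> insert k K" for k'
    proof (cases "k' = k")
      case True
      have "s * \<phi> k p = (\<Sum>i\<in>I - {p}. c i * \<phi> k i)"
        using p by (simp add: s_def sum_distrib_right)
      then show ?thesis using True sum by simp
    next
      case False
      with that c have "(\<Sum>i\<in>I - {p}. c i * \<psi> k' i) = 0" by blast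
      then have "(\<Sum>i\<in>I - {p}. c i * \<phi> k' i - c i * (\<phi> k i / \<phi> k p) * \<phi> k' p) = 0"
        by (simp add: \<psi>_def algebra_simps)
      then show ?thesis by (simp add: sum sum_subtractf s_def sum_distrib_right)
    qed
    moreover have "\<exists>i\<in>I. d i \<noteq> 0" using c(1) by (auto simp: d_def)
    ultimately show ?thesis by blast
  qed
qed

lemma cdim_ge: "c_indep_n S n \<Longrightarrow> enat n \<le> cdim S"
  unfolding cdim_def by (rule Sup_upper) blast

lemma cdim_le: "(\<And>n. c_indep_n S n \<Longrightarrow> n \<le> m) \<Longrightarrow> cdim S \<le> enat m"
  unfolding cdim_def by (rule Sup_least) auto

context lattice_basis begin

lemma multiplier_eqI:
  assumes k: "\<And>\<gamma> \<gamma>'. \<gamma> \<in> \<Gamma> \<Longrightarrow> \<gamma>' \<in> \<Gamma> \<Longrightarrow> k (\<gamma> + \<gamma>') = k \<gamma> * k \<gamma>'" "\<And>\<gamma>. \<gamma> \<in> \<Gamma> \<Longrightarrow> k \<gamma> \<noteq> 0"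
    and k': "\<And>\<gamma> \<gamma>'. \<gamma> \<in> \<Gamma> \<Longrightarrow> \<gamma>' \<in> \<Gamma> \<Longrightarrow> k' (\<gamma> + \<gamma>') = k' \<gamma> * k' \<gamma>'" "\<And>\<gamma>. \<gamma> \<in> \<Gamma> \<Longrightarrow> k' \<gamma> \<noteq> 0"
    and eq: "k \<omega>1 = k' \<omega>1" "k \<omega>2 = k' \<omega>2" and \<gamma>: "\<gamma> \<in> \<Gamma>"
  shows "k \<gamma> = (k' \<gamma> :: complex)"
proof -
  define r where "r \<gamma> = k \<gamma> / k' \<gamma>" for \<gamma>
  have r: "r (\<gamma> + \<gamma>') = r \<gamma> * r \<gamma>'" "r \<gamma> \<noteq> 0" if "\<gamma> \<in> \<Gamma>" "\<gamma>' \<in> \<Gamma>" for \<gamma> \<gamma>'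
    using that k k' by (simp_all add: r_def)
  have in_\<Gamma>: "of_int m * \<omega>1 + of_int n * \<omega>2 \<in> \<Gamma>" for m n by (auto simp: lattice_def)
  have r0: "r 0 = 1" using r[of 0 0] in_\<Gamma>[of 0 0] by simp
  have pow: "r (of_int m * \<omega>) = 1" if \<omega>: "r \<omega> = 1" "\<And>m. of_int m * \<omega> \<in> \<Gamma>" for m \<omega>
  proof (induction m rule: int_induct[where k = 0])
    case base
    show ?case using r0 by simp
  next
    case (step1 i)
    have "r (of_int i * \<omega> + of_int 1 * \<omega>) = r (of_int i * \<omega>) * r (of_int 1 * \<omega>)" by (intro r \<omega>)
    with step1 \<omega> show ?case by (simp add: algebra_simps)
  next
    case (step2 i)
    have "r (of_int (i - 1) * \<omega> + of_int 1 * \<omega>) = r (of_int (i - 1) * \<omega>) * r (of_int 1 * \<omega>)" by (intro r \<omega>)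
    with step2 \<omega> show ?case by (simp add: algebra_simps)
  qed
  obtain m n where mn: "\<gamma> = of_int m * \<omega>1 + of_int n * \<omega>2" using \<gamma> by (auto simp: lattice_def)
  have "r \<omega>1 = 1" "r \<omega>2 = 1" using eq k' basis_in_lattice by (simp_all add: r_def)
  moreover have "of_int m * \<omega>1 \<in> \<Gamma>" "of_int m * \<omega>2 \<in> \<Gamma>" for m using in_\<Gamma>[of m 0] in_\<Gamma>[of 0 m] by simp_all
  ultimately have "r \<gamma> = 1" unfolding mn by (subst r) (simp_all add: pow)
  then show ?thesis using k' \<gamma> by (simp add: r_def)
qed

end

section \<open>Resonances and the upper bound\<close>

context hs_lattice begin

text \<open>Logarithms of the signed multiplier at the two periods prescribe
  \<open>x * \<omega> + y * cnj \<omega>\<close> there; the resulting linear system for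
  \<open>x\<close> and \<open>y\<close> has a nonzero multiple of \<open>covol\<close> as
  determinant.\<close>

lemma ex_twist:
  assumes "is_multiplier \<Gamma> h"
  obtains x y where "twist h x y"
proof -
  define k where "k \<gamma> = h \<gamma> * fchar (\<beta>0 / 2) \<gamma>" for \<gamma>
  have k: "k \<gamma> \<noteq> 0" if "\<gamma> \<in> \<Gamma>" for \<gamma>
    using assms that by (simp add: k_def is_multiplier_def)
  define l1 where "l1 = Ln (k \<omega>1) / (pi * \<i>)"
  define l2 where "l2 = Ln (k \<omega>2) / (pi * \<i>)"
  define d where "d = \<omega>1 * cnj \<omega>2 - \<omega>2 * cnj \<omega>1"
  have d: "d \<noteq> 0" using covol_nonzero by (auto simp: complex_eq_iff covol_def d_def)
  define x where "x = (l1 * cnj \<omega>2 - l2 * cnj \<omega>1) / d"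
  define y where "y = (\<omega>1 * l2 - \<omega>2 * l1) / d"
  have "d * (x * \<omega>1 + y * cnj \<omega>1) = d * l1" "d * (x * \<omega>2 + y * cnj \<omega>2) = d * l2"
  proof -
    have dxy: "d * x = l1 * cnj \<omega>2 - l2 * cnj \<omega>1" "d * y = \<omega>1 * l2 - \<omega>2 * l1"
      using d by (simp_all add: x_def y_def)
    show "d * (x * \<omega>1 + y * cnj \<omega>1) = d * l1" "d * (x * \<omega>2 + y * cnj \<omega>2) = d * l2"
      unfolding distrib_left mult.assoc[symmetric] dxy by (simp_all add: d_def algebra_simps)
  qed
  then have l: "x * \<omega>1 + y * cnj \<omega>1 = l1" "x * \<omega>2 + y * cnj \<omega>2 = l2" using d by simp_all
  have e: "echar x y \<omega>1 = k \<omega>1" "echar x y \<omega>2 = k \<omega>2"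
    unfolding echar_def l l1_def l2_def using k basis_in_lattice by (simp_all add: exp_Ln)
  have "echar x y \<gamma> = k \<gamma>" if "\<gamma> \<in> \<Gamma>" for \<gamma>
    by (rule multiplier_eqI[of "echar x y" k])
       (use that k assms e in \<open>simp_all add: echar_add k_def is_multiplier_def\<close>)
  then show ?thesis using that unfolding twist_def k_def by blast
qed

definition resonances :: "complex \<Rightarrow> complex \<Rightarrow> complex set" where
  "resonances x y = {\<delta> \<in> \<Gamma>d. (x + cnj \<delta>) * (y + \<delta>) = \<beta>0 * cnj \<beta>0 / 4}"

text \<open>Testing against \<open>fchar \<delta>\<close> reads off the mode
  \<open>- \<delta>\<close>, hence the later passages to negatives.\<close>

lemma fourier_shift:
  "echar (- x) (- y) z * fchar \<delta> z = echar (- (x + cnj (- \<delta>))) (- (y + (- \<delta>))) z"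
  by (simp add: echar_mult)

lemma sections_coef_eq_0:
  assumes "\<alpha> \<in> sections h" "twist h x y" "\<delta> \<in> \<Gamma>d" "\<delta> \<notin> resonances x y"
  shows "coefU \<alpha> (x + cnj \<delta>) (y + \<delta>) = 0" "coefV \<alpha> (x + cnj \<delta>) (y + \<delta>) = 0"
proof -
  note t = twist_shift[OF assms(2,3)]
  show *: "coefU \<alpha> (x + cnj \<delta>) (y + \<delta>) = 0"
    using assms by (intro coefU_eq_0[OF assms(1) t]) (auto simp: resonances_def)
  show "coefV \<alpha> (x + cnj \<delta>) (y + \<delta>) = 0"
    by (rule coefV_eq_0[OF assms(1) t *])
qed

text \<open>A section is determined by its resonant \<open>coefU\<close>: the other
  \<open>coefU\<close> vanish by the determinant condition, each \<open>coefV\<close> vanishes along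
  with its \<open>coefU\<close>, and Fourier uniqueness yields \<open>U = V = 0\<close>, from which
  the section is recovered.\<close>

lemma lincomb_eq_0:
  fixes n :: nat
  assumes a: "\<And>k. k < n \<Longrightarrow> a k \<in> sections h" and t: "twist h x y"
    and c: "\<And>\<delta>. \<delta> \<in> resonances x y \<Longrightarrow> (\<Sum>k<n. c k * coefU (a k) (x + cnj \<delta>) (y + \<delta>)) = 0"
  shows "(\<Sum>k<n. rscale (a k z) (c k)) = 0"
proof -
  define \<alpha> where "\<alpha> z = (\<Sum>k<n. rscale (a k z) (c k))" for z
  have UV: "spU \<alpha> z = (\<Sum>k<n. c k * spU (a k) z)" "spV \<alpha> z = (\<Sum>k<n. c k * spV (a k) z)" for z
    unfolding \<alpha>_def[abs_def] by (simp_all only: spU_lincomb spV_lincomb)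
  have wh: "weak_hol (a k)" if "k < n" for k using a[OF that] by (simp add: sections_def)
  have cont: "continuous_on UNIV (spU (a k))" "continuous_on UNIV (spV (a k))" if "k < n" for k
    using weak_hol_continuous[OF wh[OF that]] by auto
  have mU: "mean (\<lambda>z. (\<Sum>k<n. c k * spU (a k) z) * echar (- p) (- q) z) = (\<Sum>k<n. c k * coefU (a k) p q)" for p q
    unfolding sum_distrib_right mult.assoc coefU_def
    by (subst mean_sum) (auto simp: mean_cmult intro!: continuous_intros cont)
  have mV: "mean (\<lambda>z. (\<Sum>k<n. c k * spV (a k) z) * echar (- p) (- q) z) = (\<Sum>k<n. c k * coefV (a k) p q)" for p q
    unfolding sum_distrib_right mult.assoc coefV_def
    by (subst mean_sum) (auto simp: mean_cmult intro!: continuous_intros cont)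
  have U0: "(\<Sum>k<n. c k * coefU (a k) (x + cnj \<delta>) (y + \<delta>)) = 0" if "\<delta> \<in> \<Gamma>d" for \<delta>
    using c sections_coef_eq_0(1)[OF a t that] by (cases "\<delta> \<in> resonances x y") simp_all
  \<comment> \<open>The combination has not been shown to lie in \<open>sections\<close>, so the
    first mode equation is summed over its terms.\<close>
  have V0: "(\<Sum>k<n. c k * coefV (a k) (x + cnj \<delta>) (y + \<delta>)) = 0" if "\<delta> \<in> \<Gamma>d" for \<delta>
  proof -
    have "cnj \<beta>0 / 2 * (\<Sum>k<n. c k * coefV (a k) (x + cnj \<delta>) (y + \<delta>)) +
        (x + cnj \<delta>) * (\<Sum>k<n. c k * coefU (a k) (x + cnj \<delta>) (y + \<delta>)) =
        (\<Sum>k<n. c k * (cnj \<beta>0 / 2 * coefV (a k) (x + cnj \<delta>) (y + \<delta>) + (x + cnj \<delta>) * coefU (a k) (x + cnj \<delta>) (y + \<delta>)))"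
      by (simp add: sum_distrib_left sum.distrib algebra_simps)
    also have "\<dots> = 0"
      using coef_equations(1)[OF a twist_shift[OF t that]] by simp
    finally show ?thesis using U0[OF that] \<beta>0_nonzero by simp
  qed
  have "spU \<alpha> z * echar (- x) (- y) z = 0" for z
  proof (rule fourier_unique[where \<phi> = "\<lambda>z. spU \<alpha> z * echar (- x) (- y) z"])
    show "continuous_on UNIV (\<lambda>z. spU \<alpha> z * echar (- x) (- y) z)"
      unfolding UV by (intro continuous_intros cont) auto
    show "periodic (\<lambda>z. spU \<alpha> z * echar (- x) (- y) z)"
      using periodic_spU[OF a t] unfolding UV sum_distrib_right mult.assoc periodic_def by simp
    fix \<delta> assume "\<delta> \<in> \<Gamma>d"
    then show "mean (\<lambda>z. spU \<alpha> z * echar (- x) (- y) z * fchar \<delta> z) = 0"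
      unfolding mult.assoc fourier_shift UV mU by (intro U0 dual_lattice_uminus)
  qed
  moreover have "spV \<alpha> z * echar (- x) (- y) z = 0" for z
  proof (rule fourier_unique[where \<phi> = "\<lambda>z. spV \<alpha> z * echar (- x) (- y) z"])
    show "continuous_on UNIV (\<lambda>z. spV \<alpha> z * echar (- x) (- y) z)"
      unfolding UV by (intro continuous_intros cont) auto
    show "periodic (\<lambda>z. spV \<alpha> z * echar (- x) (- y) z)"
      using periodic_spV[OF a t] unfolding UV sum_distrib_right mult.assoc periodic_def by simp
    fix \<delta> assume "\<delta> \<in> \<Gamma>d"
    then show "mean (\<lambda>z. spV \<alpha> z * echar (- x) (- y) z * fchar \<delta> z) = 0"
      unfolding mult.assoc fourier_shift UV mV by (intro V0 dual_lattice_uminus)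
  qed
  ultimately have "spU \<alpha> z = 0" "spV \<alpha> z = 0" by (simp_all add: mult_eq_0_iff)
  then have "\<alpha> z = 0" using fst_eq_sp[of \<alpha> z] snd_eq_sp[of \<alpha> z] by (simp add: prod_eq_iff)
  then show ?thesis by (simp add: \<alpha>_def)
qed

text \<open>With more sections than resonances, some nontrivial combination has all its resonant
  coefficients equal to zero.\<close>

lemma dim_le_resonances:
  assumes "twist h x y" "finite (resonances x y)" "c_indep_n (H0 \<Gamma> \<beta>0 h) n"
  shows "n \<le> card (resonances x y)"
proof (rule ccontr)
  assume "\<not> ?thesis"
  then have lt: "card (resonances x y) < card {..<n}" by simp
  obtain a where a: "\<And>k. k < n \<Longrightarrow> a k \<in> H0 \<Gamma> \<beta>0 h"
    and ind: "\<And>c. (\<forall>z. (\<Sum>k<n. rscale (a k z) (c k)) = 0) \<Longrightarrow> \<forall>k<n. c k = 0"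
    using assms(3) unfolding c_indep_n_def by auto
  obtain c where c: "\<exists>k\<in>{..<n}. c k \<noteq> 0"
    "\<forall>\<delta>\<in>resonances x y. (\<Sum>k<n. c k * coefU (a k) (x + cnj \<delta>) (y + \<delta>)) = 0"
    using underdetermined_system[OF assms(2) finite_lessThan lt,
        of "\<lambda>\<delta> k. coefU (a k) (x + cnj \<delta>) (y + \<delta>)"] by blast
  have "(\<Sum>k<n. rscale (a k z) (c k)) = 0" for z
    using a H0_subset_sections c(2) by (intro lincomb_eq_0[OF _ assms(1)]) auto
  with ind c(1) show False by blast
qed

lemma zero_in_H0: "(\<lambda>z. 0) \<in> H0 \<Gamma> \<beta>0 h"
  unfolding H0_def holomorphic_q_def
  by (auto intro!: exI[of _ "\<lambda>z v. 0"]) (simp_all add: qmul_def rscale_eq zero_prod_def)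

lemma Spec_nonzero_section:
  assumes "h \<in> Spec \<Gamma> \<beta>0"
  obtains \<alpha> z where "\<alpha> \<in> H0 \<Gamma> \<beta>0 h" "\<alpha> z \<noteq> 0"
proof -
  have "\<exists>\<alpha>\<in>H0 \<Gamma> \<beta>0 h. \<alpha> \<noteq> (\<lambda>z. 0)" using assms zero_in_H0 unfolding Spec_def by blast
  then show ?thesis using that by (auto simp: fun_eq_iff)
qed

lemma cdim_Spec_ge_1:
  assumes "h \<in> Spec \<Gamma> \<beta>0"
  shows "1 \<le> cdim (H0 \<Gamma> \<beta>0 h)"
proof -
  obtain \<alpha> z where \<alpha>: "\<alpha> \<in> H0 \<Gamma> \<beta>0 h" "\<alpha> z \<noteq> 0" using Spec_nonzero_section[OF assms] .
  have "c_indep_n (H0 \<Gamma> \<beta>0 h) 1"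
    unfolding c_indep_n_def
  proof (intro exI[of _ "\<lambda>_. \<alpha>"] conjI allI impI)
    fix c :: "nat \<Rightarrow> complex" and k :: nat
    assume "\<forall>z. (\<Sum>k<1. rscale (\<alpha> z) (c k)) = 0" "k < 1"
    then have "rscale (\<alpha> z) (c 0) = 0" "k = 0" by simp_all
    then show "c k = 0" using \<alpha>(2) by (auto simp: rscale_eq zero_prod_def prod_eq_iff)
  qed (use \<alpha> in simp)
  then show ?thesis using cdim_ge by (metis one_enat_def)
qed

text \<open>A nonzero section forces some resonance to exist; shifting the twist by it moves this
  resonance to \<open>0\<close>.\<close>

lemma Spec_normalized_twist:
  assumes "h \<in> Spec \<Gamma> \<beta>0"
  obtains x y where "twist h x y" "x * y = \<beta>0 * cnj \<beta>0 / 4"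
proof -
  obtain x y where t: "twist h x y" using assms ex_twist unfolding Spec_def by blast
  obtain \<alpha> z where \<alpha>: "\<alpha> \<in> H0 \<Gamma> \<beta>0 h" "\<alpha> z \<noteq> 0" using Spec_nonzero_section[OF assms] .
  have "resonances x y \<noteq> {}"
  proof
    assume "resonances x y = {}"
    then have "(\<Sum>k<1::nat. rscale (\<alpha> z) 1) = 0"
      using \<alpha>(1) H0_subset_sections by (intro lincomb_eq_0[where a = "\<lambda>_. \<alpha>", OF _ t]) auto
    with \<alpha>(2) show False by (simp add: rscale_eq)
  qed
  then show ?thesis using that twist_shift[OF t] unfolding resonances_def by blast
qed

lemma boundN_eq: "boundN \<Gamma> \<beta>0 = card (\<Gamma>d \<inter> cball 0 (norm \<beta>0))"
proof -
  have "{\<delta> + \<beta>0 / 2 | \<delta>. \<delta> \<in> \<Gamma>d} \<inter> cball (\<beta>0 / 2) (cmod \<beta>0) = (\<lambda>\<delta>. \<delta> + \<beta>0 / 2) ` (\<Gamma>d \<inter> cball 0 (norm \<beta>0))"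
    by (auto simp: dist_norm norm_minus_commute)
  then show ?thesis unfolding boundN_def by (simp add: card_image)
qed

text \<open>The disk always contains the dual vectors \<open>0\<close> and \<beta>0. This covers the
  case of unequal norms in \<open>resonances_card\<close>, where up to two resonances occur.\<close>

lemma boundN_ge_2: "2 \<le> boundN \<Gamma> \<beta>0"
proof -
  have "card {0, \<beta>0} \<le> card (\<Gamma>d \<inter> cball 0 (norm \<beta>0))"
    by (rule card_mono[OF finite_dual_lattice_cball]) (use \<beta>0_dual dual_lattice_0 in auto)
  then show ?thesis using \<beta>0_nonzero by (simp add: boundN_eq)
qed

lemma resonance_iff:
  assumes "x * y = \<beta>0 * cnj \<beta>0 / 4"
  shows "\<delta> \<in> resonances x y \<longleftrightarrow> \<delta> \<in> \<Gamma>d \<and> x * \<delta> + y * cnj \<delta> = - of_real ((norm \<delta>)\<^sup>2)"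
proof -
  have "(x + cnj \<delta>) * (y + \<delta>) = x * y + (x * \<delta> + y * cnj \<delta> + of_real ((norm \<delta>)\<^sup>2))"
    unfolding complex_norm_square by (simp add: algebra_simps)
  then show ?thesis
    unfolding resonances_def assms[symmetric] mem_Collect_eq by (simp add: eq_neg_iff_add_eq_0)
qed

lemma norm_resonance_le:
  assumes "x * y = \<beta>0 * cnj \<beta>0 / 4" "\<delta> \<in> resonances x y"
  shows "norm \<delta> \<le> norm x + norm y"
proof (cases "\<delta> = 0")
  case False
  have "(norm \<delta>)\<^sup>2 = norm (x * \<delta> + y * cnj \<delta>)"
    using assms by (simp add: resonance_iff del: of_real_power)
  also have "\<dots> \<le> norm x * norm \<delta> + norm y * norm \<delta>"
    using norm_triangle_ineq[of "x * \<delta>" "y * cnj \<delta>"] by (simp add: norm_mult)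
  finally have "norm \<delta> * norm \<delta> \<le> (norm x + norm y) * norm \<delta>" by (simp add: power2_eq_square algebra_simps)
  then show ?thesis using False by simp
qed simp

text \<open>As \<open>x * y\<close> is real and positive, \<open>y\<close> is a positive multiple
  \<open>t\<close> of \<open>cnj x\<close>. For \<open>t = 1\<close> both norms are half of
  \<open>norm \<beta>0\<close>, and \<open>norm_resonance_le\<close> gives the radius of the disk.
  For other \<open>t\<close> the resonance equation forces \<open>x * \<delta>\<close> to be real,
  and a quadratic equation leaves one nonzero value.\<close>

lemma resonances_card:
  assumes xy: "x * y = \<beta>0 * cnj \<beta>0 / 4"
  shows "finite (resonances x y)" "card (resonances x y) \<le> boundN \<Gamma> \<beta>0"
proof -
  have sub: "resonances x y \<subseteq> \<Gamma>d \<inter> cball 0 (norm x + norm y)"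
    using norm_resonance_le[OF xy] by (auto simp: resonances_def)
  then show "finite (resonances x y)" by (rule finite_subset) (rule finite_dual_lattice_cball)
  have nxy: "norm x * norm y = (norm \<beta>0 / 2)\<^sup>2"
    using arg_cong[OF xy, of norm] by (simp add: norm_mult norm_divide power2_eq_square)
  have x: "x \<noteq> 0" using xy \<beta>0_nonzero by auto
  \<comment> \<open>This is \<open>norm y / norm x\<close>, written with \<open>norm x\<close> alone
    by means of the product \<open>x * y\<close>.\<close>
  define t where "t = (norm \<beta>0)\<^sup>2 / (4 * (norm x)\<^sup>2)"
  have t: "t > 0" using x \<beta>0_nonzero by (simp add: t_def)
  have y: "y = of_real t * cnj x"
  proof -
    have "x * (of_real t * cnj x) = of_real t * of_real ((norm x)\<^sup>2)" unfolding complex_norm_square by simp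
    also have "\<dots> = of_real ((norm \<beta>0)\<^sup>2) / 4"
      using x by (simp add: t_def)
    also have "\<dots> = x * y" unfolding complex_norm_square xy by simp
    finally show ?thesis using x by simp
  qed
  show "card (resonances x y) \<le> boundN \<Gamma> \<beta>0"
  proof (cases "t = 1")
    case True
    then have "norm x = norm y" using y by simp
    then have "norm x = norm \<beta>0 / 2" using nxy power2_eq_imp_eq[of "norm x" "norm \<beta>0 / 2"] by (simp add: power2_eq_square)
    then have "norm x + norm y = norm \<beta>0" using \<open>norm x = norm y\<close> by simp
    then show ?thesis unfolding boundN_eq using sub card_mono[OF finite_dual_lattice_cball] by metis
  next
    case False
    have "\<delta> = of_real (- (1 + t)) * cnj x" if \<delta>: "\<delta> \<in> resonances x y" "\<delta> \<noteq> 0" for \<delta>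
    proof -
      define w where "w = x * \<delta>"
      have w: "w + of_real t * cnj w = - of_real ((norm \<delta>)\<^sup>2)"
      proof -
        have "x * \<delta> + y * cnj \<delta> = - of_real ((norm \<delta>)\<^sup>2)"
          using \<delta>(1) unfolding resonance_iff[OF xy] by blast
        then show ?thesis unfolding w_def y by (simp add: mult_ac)
      qed
      \<comment> \<open>The right-hand side of \<open>w\<close> is real, and conjugation turns the
        weight \<open>1 + t\<close> of the real part into \<open>1 - t\<close> for the imaginary
        part.\<close>
      have "(1 - t) * Im w = 0" using arg_cong[OF w, of Im] by (simp add: algebra_simps)
      then have Im: "Im w = 0" using False by simp
      have Re: "(1 + t) * Re w = - (norm \<delta>)\<^sup>2" using arg_cong[OF w, of Re] by (simp add: algebra_simps)
      have wr: "w = of_real (Re w)" using Im by (simp add: complex_eq_iff)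
      have "(norm w)\<^sup>2 = (norm x)\<^sup>2 * (norm \<delta>)\<^sup>2" by (simp add: w_def norm_mult power_mult_distrib)
      moreover have "(norm w)\<^sup>2 = (Re w)\<^sup>2" by (simp add: cmod_power2 Im)
      ultimately have "(Re w)\<^sup>2 = - (norm x)\<^sup>2 * ((1 + t) * Re w)" unfolding Re by simp
      then have "Re w * (Re w + (norm x)\<^sup>2 * (1 + t)) = 0" by (simp add: power2_eq_square algebra_simps)
      moreover have "w \<noteq> 0" using x \<delta> by (simp add: w_def)
      then have "Re w \<noteq> 0" using wr by (metis of_real_0)
      ultimately have "Re w + (norm x)\<^sup>2 * (1 + t) = 0" by (metis mult_eq_0_iff)
      then have "Re w = - (1 + t) * (norm x)\<^sup>2" by (simp add: algebra_simps)
      then have "w = of_real (- (1 + t)) * of_real ((norm x)\<^sup>2)" using wr by (metis of_real_mult)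
      then have "x * \<delta> = x * (of_real (- (1 + t)) * cnj x)"
        unfolding complex_norm_square w_def by (simp add: mult_ac)
      then show ?thesis using x by simp
    qed
    then have "resonances x y \<subseteq> {0, of_real (- (1 + t)) * cnj x}" by blast
    then have "card (resonances x y) \<le> card {0, of_real (- (1 + t)) * cnj x}" by (intro card_mono) auto
    also have "\<dots> \<le> 2" by (simp add: card_insert_if)
    finally show ?thesis using boundN_ge_2 by simp
  qed
qed

lemma cdim_le_resonances:
  assumes "twist h x y" "x * y = \<beta>0 * cnj \<beta>0 / 4"
  shows "cdim (H0 \<Gamma> \<beta>0 h) \<le> enat (card (resonances x y))"
  using dim_le_resonances[OF assms(1) resonances_card(1)[OF assms(2)]] by (rule cdim_le)

lemma cdim_le_boundN:
  assumes "h \<in> Spec \<Gamma> \<beta>0"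
  shows "cdim (H0 \<Gamma> \<beta>0 h) \<le> enat (boundN \<Gamma> \<beta>0)"
proof -
  obtain x y where xy: "twist h x y" "x * y = \<beta>0 * cnj \<beta>0 / 4" using Spec_normalized_twist[OF assms] .
  then show ?thesis
    using cdim_le_resonances[OF xy] resonances_card(2)[OF xy(2)] by (meson enat_ord_simps(1) order_trans)
qed

section \<open>Discreteness of the multipliers with larger dimension\<close>

definition jump :: "(complex \<Rightarrow> complex) set" where
  "jump = {h \<in> Spec \<Gamma> \<beta>0. cdim (H0 \<Gamma> \<beta>0 h) \<noteq> 1}"

text \<open>For a normalised twist \<open>0\<close> is a resonance. Were it the only one, the
  dimension would be at most 1, and on the spectrum it is at least 1.\<close>

lemma jump_resonance:
  assumes "h \<in> jump"
  obtains x y \<delta> where "twist h x y" "x * y = \<beta>0 * cnj \<beta>0 / 4" "\<delta> \<in> resonances x y" "\<delta> \<noteq> 0"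
proof -
  have h: "h \<in> Spec \<Gamma> \<beta>0" "cdim (H0 \<Gamma> \<beta>0 h) \<noteq> 1" using assms by (auto simp: jump_def)
  obtain x y where xy: "twist h x y" "x * y = \<beta>0 * cnj \<beta>0 / 4" using Spec_normalized_twist[OF h(1)] .
  have "\<not> resonances x y \<subseteq> {0}"
  proof
    assume "resonances x y \<subseteq> {0}"
    then have "card (resonances x y) \<le> card {0::complex}" by (intro card_mono) auto
    then have "cdim (H0 \<Gamma> \<beta>0 h) \<le> enat 1"
      using cdim_le_resonances[OF xy] by (simp add: order_trans[of _ "enat (card (resonances x y))"])
    then show False using h cdim_Spec_ge_1[OF h(1)] by (simp add: one_enat_def)
  qed
  then show ?thesis using that xy by blast
qed

text \<open>Multiplying the linear equation by \<open>x\<close> and inserting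
  \<open>x * y = R\<close> gives a quadratic equation for \<open>x\<close> with leading coefficient
  \<delta>; then \<open>y\<close> is determined because \<open>cnj \<delta>\<close> is
  nonzero.\<close>

lemma finite_resonant_parameters:
  assumes "\<delta> \<noteq> 0"
  shows "finite {(x, y). x * y = R \<and> x * \<delta> + y * cnj \<delta> = - of_real ((norm \<delta>)\<^sup>2)}"
proof -
  define p where "p = [: R * cnj \<delta>, of_real ((norm \<delta>)\<^sup>2), \<delta> :]"
  have "p \<noteq> 0" using assms by (simp add: p_def)
  then have fin: "finite {x. poly p x = 0}" by (rule poly_roots_finite)
  have "{(x, y). x * y = R \<and> x * \<delta> + y * cnj \<delta> = - of_real ((norm \<delta>)\<^sup>2)} \<subseteq>
    (\<lambda>x. (x, (- of_real ((norm \<delta>)\<^sup>2) - x * \<delta>) / cnj \<delta>)) ` {x. poly p x = 0}"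
  proof clarify
    fix x y assume 1: "x * \<delta> + y * cnj \<delta> = - of_real ((norm \<delta>)\<^sup>2)" and R: "R = x * y"
    then have "y * cnj \<delta> = - of_real ((norm \<delta>)\<^sup>2) - x * \<delta>" by (simp add: algebra_simps)
    then have "y = (- of_real ((norm \<delta>)\<^sup>2) - x * \<delta>) / cnj \<delta>" using assms by (simp add: field_simps)
    moreover have "poly p x = x * (x * \<delta> + y * cnj \<delta> + of_real ((norm \<delta>)\<^sup>2))"
      by (simp add: p_def R algebra_simps)
    then have "poly p x = 0" unfolding 1 by simp
    ultimately show "(x, y) \<in> (\<lambda>x. (x, (- of_real ((norm \<delta>)\<^sup>2) - x * \<delta>) / cnj \<delta>)) ` {x. poly p x = 0}"
      by blast
  qed
  then show ?thesis using fin by (meson finite_imageI finite_subset)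
qed

text \<open>Inverts \<open>twist\<close>: the phase is a sign on the lattice, so multiplying by it
  also removes it. The value 1 elsewhere is the convention of \<open>is_multiplier\<close>.\<close>

definition multiplier_of :: "complex \<Rightarrow> complex \<Rightarrow> complex \<Rightarrow> complex" where
  "multiplier_of x y \<gamma> = (if \<gamma> \<in> \<Gamma> then echar x y \<gamma> * fchar (\<beta>0 / 2) \<gamma> else 1)"

lemma multiplier_of_twist:
  assumes "is_multiplier \<Gamma> h" "twist h x y"
  shows "h = multiplier_of x y"
proof
  fix \<gamma>
  show "h \<gamma> = multiplier_of x y \<gamma>"
  proof (cases "\<gamma> \<in> \<Gamma>")
    case True
    then have "multiplier_of x y \<gamma> = h \<gamma> * (fchar (\<beta>0 / 2) \<gamma> * fchar (\<beta>0 / 2) \<gamma>)"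
      using assms(2) by (simp add: multiplier_of_def twist_def)
    then show ?thesis using fchar_half_lattice(2)[OF True] by simp
  qed (use assms(1) in \<open>simp add: multiplier_of_def is_multiplier_def\<close>)
qed

text \<open>The imaginary part of \<open>x * \<gamma> + y * cnj \<gamma>\<close> is that of
  \<open>(x - cnj y) * \<gamma>\<close>, so absolute values of the multiplier on the periods control
  \<open>x - cnj y\<close>.\<close>

lemma norm_multiplier:
  assumes "twist h x y" "\<gamma> \<in> \<Gamma>"
  shows "norm (h \<gamma>) = exp (- pi * Im ((x - cnj y) * \<gamma>))"
proof -
  have "norm (h \<gamma>) = norm (echar x y \<gamma>)"
  proof -
    have "norm (fchar (\<beta>0 / 2) \<gamma>) = 1" unfolding fchar_eq_cis by (rule norm_cis)
    then show ?thesis using assms by (simp add: twist_def norm_mult)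
  qed
  then show ?thesis by (simp add: echar_def algebra_simps)
qed

text \<open>Near a fixed multiplier \<open>x - cnj y\<close> is bounded, and together with the value of \<open>x * y\<close> this
  bounds \<open>x\<close> and \<open>y\<close>; hence only finitely many resonances, each with finitely many parameters, occur.\<close>
lemma discrete_jump: "discrete_in \<omega>1 \<omega>2 jump (Spec \<Gamma> \<beta>0)"
  unfolding discrete_in_def
proof
  fix h assume h: "h \<in> Spec \<Gamma> \<beta>0"
  define R where "R = \<beta>0 * cnj \<beta>0 / 4"
  have nz: "h \<omega>1 \<noteq> 0" "h \<omega>2 \<noteq> 0" using h basis_in_lattice by (auto simp: Spec_def is_multiplier_def)
  \<comment> \<open>Half the smaller norm keeps the values of nearby multipliers on the periods
    between \<open>norm (h \<omega>) / 2\<close> and \<open>2 * norm (h \<omega>)\<close>, so their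
    logarithms are bounded by the terms in \<open>L\<close>.\<close>
  define e where "e = min (norm (h \<omega>1)) (norm (h \<omega>2)) / 2"
  have e: "e > 0" using nz by (simp add: e_def)
  define L where "L \<omega> = (\<bar>ln (norm (h \<omega>) / 2)\<bar> + \<bar>ln (2 * norm (h \<omega>))\<bar>) / pi" for \<omega>
  define B where "B = L \<omega>1 * norm dual1 + L \<omega>2 * norm dual2"
  define r where "r = norm \<beta>0 / 2"
  have r: "r > 0" using \<beta>0_nonzero by (simp add: r_def)
  \<comment> \<open>From \<open>norm x * norm y = r * r\<close> one of the norms is at most
    \<open>r\<close>, and the other then at most \<open>B + r\<close>. So their sum, which bounds
    every resonance, is at most \<open>2 * (B + r)\<close>.\<close>
  define F where "F = \<Gamma>d \<inter> cball 0 (2 * (B + r)) - {0}"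
  define P where "P = (\<Union>\<delta>\<in>F. {(x, y). x * y = R \<and> x * \<delta> + y * cnj \<delta> = - of_real ((norm \<delta>)\<^sup>2)})"
  have "finite P" unfolding P_def F_def
    using finite_dual_lattice_cball by (intro finite_UN_I finite_resonant_parameters) auto
  moreover have "{h' \<in> jump. cmod (h' \<omega>1 - h \<omega>1) < e \<and> cmod (h' \<omega>2 - h \<omega>2) < e} \<subseteq> (\<lambda>(x, y). multiplier_of x y) ` P"
  proof clarify
    fix h' assume h': "h' \<in> jump" and near: "cmod (h' \<omega>1 - h \<omega>1) < e" "cmod (h' \<omega>2 - h \<omega>2) < e"
    obtain x y \<delta> where xy: "twist h' x y" "x * y = \<beta>0 * cnj \<beta>0 / 4" and \<delta>: "\<delta> \<in> resonances x y" "\<delta> \<noteq> 0"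
      using jump_resonance[OF h'] .
    \<comment> \<open>Chosen so that pairing with \<omega> gives
      \<open>Im ((x - cnj y) * \<omega>)\<close>; \<open>dual_expansion\<close> then bounds
      \<open>norm v = norm (x - cnj y)\<close> by the pairings with the two periods.\<close>
    define v where "v = \<i> * cnj (x - cnj y)"
    have inner_v: "\<bar>inner v \<omega>\<bar> \<le> L \<omega>"
      if "\<omega> \<in> \<Gamma>" "h \<omega> \<noteq> 0" "cmod (h' \<omega> - h \<omega>) < norm (h \<omega>) / 2" for \<omega>
    proof -
      have iv: "inner v \<omega> = Im ((x - cnj y) * \<omega>)" by (simp add: v_def inner_complex_def algebra_simps)
      have n: "norm (h' \<omega>) = exp (- pi * inner v \<omega>)" unfolding iv by (rule norm_multiplier[OF xy(1) that(1)])
      have "norm (h \<omega>) / 2 \<le> norm (h' \<omega>)" "norm (h' \<omega>) \<le> 2 * norm (h \<omega>)"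
        using that(3) norm_triangle_ineq2[of "h \<omega>" "h' \<omega>"] norm_triangle_ineq2[of "h' \<omega>" "h \<omega>"]
          norm_minus_commute[of "h \<omega>" "h' \<omega>"] norm_ge_zero[of "h \<omega>"] by linarith+
      moreover have "norm (h' \<omega>) > 0" by (simp only: n exp_gt_zero)
      ultimately have "ln (norm (h \<omega>) / 2) \<le> ln (norm (h' \<omega>))" "ln (norm (h' \<omega>)) \<le> ln (2 * norm (h \<omega>))"
        using that(2) by simp_all
      then have "\<bar>pi * inner v \<omega>\<bar> \<le> \<bar>ln (norm (h \<omega>) / 2)\<bar> + \<bar>ln (2 * norm (h \<omega>))\<bar>"
        unfolding n by simp
      then have "pi * \<bar>inner v \<omega>\<bar> \<le> pi * L \<omega>" by (simp add: L_def abs_mult)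
      then show ?thesis by simp
    qed
    have nv: "norm (x - cnj y) \<le> B"
    proof -
      have "norm (x - cnj y) = norm v" by (simp add: v_def norm_mult del: complex_cnj_diff)
      also have "\<dots> = norm (of_real (inner v \<omega>1) * dual1 + of_real (inner v \<omega>2) * dual2)"
        by (subst dual_expansion[of v]) simp
      also have "\<dots> \<le> \<bar>inner v \<omega>1\<bar> * norm dual1 + \<bar>inner v \<omega>2\<bar> * norm dual2"
        using norm_triangle_ineq[of "of_real (inner v \<omega>1) * dual1" "of_real (inner v \<omega>2) * dual2"]
        by (simp add: norm_mult)
      also have "\<dots> \<le> B" unfolding B_def
        using near nz basis_in_lattice by (intro add_mono mult_right_mono inner_v) (auto simp: e_def)
      finally show ?thesis .
    qed
    have nxy: "norm x * norm y = r * r"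
      using arg_cong[OF xy(2), of norm] by (simp add: norm_mult norm_divide r_def)
    have d: "norm x \<le> B + norm y" "norm y \<le> B + norm x"
      using nv norm_triangle_ineq2[of x "cnj y"] norm_triangle_ineq2[of "cnj y" x] norm_minus_commute[of x "cnj y"]
      by simp_all
    have "norm x \<le> r \<or> norm y \<le> r"
    proof (rule ccontr)
      assume "\<not> ?thesis"
      then have "r * r < norm x * norm y" using r by (intro mult_strict_mono) auto
      with nxy show False by simp
    qed
    moreover have "B \<ge> 0" using nv norm_ge_zero order_trans by blast
    ultimately have "norm x + norm y \<le> 2 * (B + r)" using d by auto
    then have "\<delta> \<in> F" using norm_resonance_le[OF xy(2) \<delta>(1)] \<delta> by (auto simp: F_def resonances_def)
    then have "(x, y) \<in> P" using \<delta>(1) xy(2) unfolding resonance_iff[OF xy(2)] P_def R_def by blast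
    moreover have "h' = multiplier_of x y"
      using h' xy(1) by (intro multiplier_of_twist) (auto simp: jump_def Spec_def)
    ultimately show "h' \<in> (\<lambda>(x, y). multiplier_of x y) ` P" by (intro image_eqI[of _ _ "(x, y)"]) simp_all
  qed
  ultimately have "finite {h' \<in> jump. cmod (h' \<omega>1 - h \<omega>1) < e \<and> cmod (h' \<omega>2 - h \<omega>2) < e}"
    by (meson finite_imageI finite_subset)
  with e show "\<exists>e>0. finite {h' \<in> jump. cmod (h' \<omega>1 - h \<omega>1) < e \<and> cmod (h' \<omega>2 - h \<omega>2) < e}" by blast
qed

end

section \<open>The trivial multiplier\<close>

lemma qmul_assoc: "qmul (qmul p q) r = qmul p (qmul q r)"
  by (simp add: qmul_def prod_eq_iff algebra_simps)

lemma qmul_1_left: "qmul (1, 0) q = q"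
  by (simp add: qmul_def)

text \<open>\<open>i\<close> anticommutes with \<open>j\<close>, so moving \<open>i\<close> to the
  right past the half-angle exponential inverts the latter, and one half of the full angle
  remains.\<close>

lemma normalN_expj_half:
  "qmul (normalN \<beta>0 z) (expj (betaf \<beta>0 z / 2)) = qmul (expj (betaf \<beta>0 z / 2)) (qofc \<i>)"
proof -
  define t where "t = betaf \<beta>0 z / 2"
  have t: "betaf \<beta>0 z = 2 * t" by (simp add: t_def)
  have "cos (2 * t) * cos t + sin (2 * t) * sin t = cos t" "sin (2 * t) * cos t - cos (2 * t) * sin t = sin t"
    using cos_diff[of "2 * t" t] sin_diff[of "2 * t" t] by simp_all
  then show ?thesis
    unfolding normalN_def t by (simp add: qmul_def qofc_def expj_def prod_eq_iff complex_eq_iff algebra_simps)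
qed

lemma qmul_expj_eq_0: "qmul (qmul (expj t) (qofc 1)) g = 0 \<Longrightarrow> g = 0"
proof -
  assume "qmul (qmul (expj t) (qofc 1)) g = 0"
  then have "qmul (qmul (expj (- t)) (expj t)) g = 0"
    by (simp add: qmul_assoc) (simp add: qmul_def qofc_def zero_prod_def)
  moreover have "of_real (cos t) * of_real (cos t) + of_real (sin t) * of_real (sin t) = (1 :: complex)"
    by (simp flip: of_real_mult of_real_add)
  then have "qmul (expj (- t)) (expj t) = (1, 0)" by (simp add: qmul_def expj_def)
  ultimately show ?thesis by (simp add: qmul_1_left)
qed

section \<open>Regularity of periodic sections\<close>

definition C1_fun :: "(complex \<Rightarrow> complex) \<Rightarrow> bool" where
  "C1_fun \<phi> \<longleftrightarrow> (\<exists>D. (\<forall>z. (\<phi> has_derivative D z) (at z)) \<and> (\<forall>v. continuous_on UNIV (\<lambda>z. D z v)))"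

lemma C1_fun_continuous: "C1_fun \<phi> \<Longrightarrow> continuous_on UNIV \<phi>"
  unfolding C1_fun_def by (meson continuous_at_imp_continuous_on has_derivative_continuous)

lemma C1_fun_const: "C1_fun (\<lambda>z. c)"
  unfolding C1_fun_def by (intro exI[of _ "\<lambda>z v. 0"]) auto

lemma C1_fun_add: assumes "C1_fun \<phi>" "C1_fun \<psi>" shows "C1_fun (\<lambda>z. \<phi> z + \<psi> z)"
proof -
  obtain D E where "\<forall>z. (\<phi> has_derivative D z) (at z)" "\<forall>v. continuous_on UNIV (\<lambda>z. D z v)"
    "\<forall>z. (\<psi> has_derivative E z) (at z)" "\<forall>v. continuous_on UNIV (\<lambda>z. E z v)"
    using assms unfolding C1_fun_def by blast
  then show ?thesis unfolding C1_fun_def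
    by (intro exI[of _ "\<lambda>z v. D z v + E z v"]) (auto intro!: continuous_intros has_derivative_add)
qed

lemma C1_fun_mult: assumes "C1_fun \<phi>" "C1_fun \<psi>" shows "C1_fun (\<lambda>z. \<phi> z * \<psi> z)"
proof -
  note c = assms[THEN C1_fun_continuous]
  obtain D E where "\<forall>z. (\<phi> has_derivative D z) (at z)" "\<forall>v. continuous_on UNIV (\<lambda>z. D z v)"
    "\<forall>z. (\<psi> has_derivative E z) (at z)" "\<forall>v. continuous_on UNIV (\<lambda>z. E z v)"
    using assms unfolding C1_fun_def by blast
  then show ?thesis unfolding C1_fun_def
    by (intro exI[of _ "\<lambda>z v. \<phi> z * E z v + D z v * \<psi> z"]) (auto intro!: continuous_intros c has_derivative_mult)
qed

lemma C1_fun_echar: "C1_fun (echar x y)"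
  unfolding C1_fun_def using echar_has_derivative[of x y]
  by (intro exI[of _ "\<lambda>z v. echar x y z * (of_real pi * \<i> * (x * v + y * cnj v))"])
     (auto intro!: continuous_intros)

lemma C1_fun_sum: "(\<And>i. i \<in> S \<Longrightarrow> C1_fun (\<phi> i)) \<Longrightarrow> C1_fun (\<lambda>z. \<Sum>i\<in>S. \<phi> i z)"
  by (induction S rule: infinite_finite_induct) (auto intro: C1_fun_const C1_fun_add)

context lattice_basis begin

text \<open>Subtracting the finite sum removes every remaining coefficient by orthogonality of the
  characters, so \<open>fourier_unique\<close> applies to the difference.\<close>

lemma fourier_finite_sum:
  assumes \<phi>: "continuous_on UNIV \<phi>" "periodic \<phi>" and S: "finite S" "S \<subseteq> \<Gamma>d"
    and 0: "\<And>\<delta>. \<delta> \<in> \<Gamma>d - S \<Longrightarrow> mean (\<lambda>z. \<phi> z * fchar (- \<delta>) z) = 0"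
  shows "\<phi> z = (\<Sum>\<delta>\<in>S. mean (\<lambda>z. \<phi> z * fchar (- \<delta>) z) * fchar \<delta> z)"
proof -
  define m where "m \<delta> = mean (\<lambda>z. \<phi> z * fchar (- \<delta>) z)" for \<delta>
  define \<psi> where "\<psi> z = \<phi> z - (\<Sum>\<delta>\<in>S. m \<delta> * fchar \<delta> z)" for z
  have "\<psi> z = 0"
  proof (rule fourier_unique[where \<phi> = \<psi>])
    show "continuous_on UNIV \<psi>" unfolding \<psi>_def by (intro continuous_intros \<phi>)
    show "periodic \<psi>"
      using \<phi>(2) periodic_fchar S(2) unfolding \<psi>_def periodic_def
      by (auto intro!: sum.cong arg_cong2[where f = minus])
    fix \<epsilon> assume \<epsilon>: "\<epsilon> \<in> \<Gamma>d"
    have "\<psi> z * fchar \<epsilon> z = \<phi> z * fchar (- (- \<epsilon>)) z - (\<Sum>\<delta>\<in>S. m \<delta> * fchar (\<delta> + \<epsilon>) z)" for z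
    proof -
      have "fchar (\<delta> + \<epsilon>) z = fchar \<delta> z * fchar \<epsilon> z" for \<delta> by (simp add: echar_mult)
      then show ?thesis by (simp add: \<psi>_def left_diff_distrib sum_distrib_right mult.assoc)
    qed
    then have "mean (\<lambda>z. \<psi> z * fchar \<epsilon> z) = mean (\<lambda>z. \<phi> z * fchar (- (- \<epsilon>)) z - (\<Sum>\<delta>\<in>S. m \<delta> * fchar (\<delta> + \<epsilon>) z))"
      by presburger
    also have "\<dots> = m (- \<epsilon>) - mean (\<lambda>z. \<Sum>\<delta>\<in>S. m \<delta> * fchar (\<delta> + \<epsilon>) z)"
      unfolding m_def by (rule mean_diff) (intro continuous_intros \<phi>)+
    also have "mean (\<lambda>z. \<Sum>\<delta>\<in>S. m \<delta> * fchar (\<delta> + \<epsilon>) z) = (\<Sum>\<delta>\<in>S. if \<delta> = - \<epsilon> then m \<delta> else 0)"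
    proof (subst mean_sum[OF S(1)])
      show "continuous_on UNIV (\<lambda>z. m \<delta> * fchar (\<delta> + \<epsilon>) z)" for \<delta> by (intro continuous_intros)
      show "(\<Sum>\<delta>\<in>S. mean (\<lambda>z. m \<delta> * fchar (\<delta> + \<epsilon>) z)) = (\<Sum>\<delta>\<in>S. if \<delta> = - \<epsilon> then m \<delta> else 0)"
        unfolding mean_cmult using S(2) \<epsilon>
        by (intro sum.cong refl, subst mean_fchar)
           (auto intro: dual_lattice_add simp: eq_neg_iff_add_eq_0)
    qed
    also have "\<dots> = (if - \<epsilon> \<in> S then m (- \<epsilon>) else 0)" using S(1) by simp
    also have "m (- \<epsilon>) - \<dots> = 0" using 0[of "- \<epsilon>"] dual_lattice_uminus[OF \<epsilon>] unfolding m_def by auto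
    finally show "mean (\<lambda>z. \<psi> z * fchar \<epsilon> z) = 0" .
  qed
  then show ?thesis by (simp add: \<psi>_def m_def)
qed

end

context hs_lattice begin

text \<open>For \<open>h = 1\<close> the half-angle phase itself is a twist, and its exponents
  already have the normalised product.\<close>

lemma twist_trivial: "twist (\<lambda>_. 1) (cnj (\<beta>0 / 2)) (\<beta>0 / 2)"
  by (simp add: twist_def)

text \<open>Only finitely many Fourier modes of a section survive, so the \<open>C\<^sup>1\<close> clause of \<open>holomorphic_q\<close>
  is automatic for it; the derivative of the torus itself is not assumed to be continuous.\<close>
lemma sections_trivial_subset_H0: "sections (\<lambda>_. 1) \<subseteq> H0 \<Gamma> \<beta>0 (\<lambda>_. 1)"
proof
  fix \<alpha> assume \<alpha>: "\<alpha> \<in> sections (\<lambda>_. 1)"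
  define x y where "x = cnj (\<beta>0 / 2)" and "y = \<beta>0 / 2"
  have t: "twist (\<lambda>_. 1) x y" unfolding x_def y_def by (rule twist_trivial)
  have xy: "x * y = \<beta>0 * cnj \<beta>0 / 4" by (simp add: x_def y_def)
  note fin = resonances_card(1)[OF xy]
  have sub: "resonances x y \<subseteq> \<Gamma>d" by (auto simp: resonances_def)
  have wh: "weak_hol \<alpha>" using \<alpha> by (simp add: sections_def)
  note c = weak_hol_continuous[OF wh]
  have shift: "echar (- x) (- y) z * fchar (- \<delta>) z = echar (- (x + cnj \<delta>)) (- (y + \<delta>)) z" for z \<delta>
    by (simp add: echar_mult)
  have inv: "echar (- x) (- y) z * echar x y z = 1" for z by (simp add: echar_mult)
  have C1: "C1_fun \<phi>"
    if \<phi>: "continuous_on UNIV \<phi>" "periodic (\<lambda>z. \<phi> z * echar (- x) (- y) z)"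
      "\<And>\<delta>. \<delta> \<in> \<Gamma>d - resonances x y \<Longrightarrow> mean (\<lambda>z. \<phi> z * echar (- (x + cnj \<delta>)) (- (y + \<delta>)) z) = 0" for \<phi>
  proof -
    define m where "m \<delta> = mean (\<lambda>z. \<phi> z * echar (- (x + cnj \<delta>)) (- (y + \<delta>)) z)" for \<delta>
    have m: "\<phi> z * echar (- x) (- y) z = (\<Sum>\<delta>\<in>resonances x y. m \<delta> * fchar \<delta> z)" for z
      unfolding m_def shift[symmetric] mult.assoc[symmetric]
    proof (rule fourier_finite_sum[OF _ \<phi>(2) fin sub])
      show "continuous_on UNIV (\<lambda>z. \<phi> z * echar (- x) (- y) z)" by (intro continuous_intros \<phi>(1))
      show "mean (\<lambda>z. \<phi> z * echar (- x) (- y) z * fchar (- \<delta>) z) = 0" if "\<delta> \<in> \<Gamma>d - resonances x y" for \<delta>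
        using \<phi>(3)[OF that] unfolding mult.assoc shift .
    qed
    have "\<phi> = (\<lambda>z. (\<Sum>\<delta>\<in>resonances x y. m \<delta> * fchar \<delta> z) * echar x y z)"
      unfolding m[symmetric] mult.assoc inv by simp
    moreover have "C1_fun (\<lambda>z. (\<Sum>\<delta>\<in>resonances x y. m \<delta> * fchar \<delta> z) * echar x y z)"
      by (intro C1_fun_mult C1_fun_sum C1_fun_const C1_fun_echar)
    ultimately show ?thesis by metis
  qed
  have U: "C1_fun (spU \<alpha>)"
    using sections_coef_eq_0(1)[OF \<alpha> t] by (intro C1 c periodic_spU[OF \<alpha> t]) (auto simp: coefU_def)
  have V: "C1_fun (spV \<alpha>)"
    using sections_coef_eq_0(2)[OF \<alpha> t] by (intro C1 c periodic_spV[OF \<alpha> t]) (auto simp: coefV_def)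
  have "C1_fun (\<lambda>z. (1 / 4) * (fchar (\<beta>0 / 2) z * (spU \<alpha> z + spV \<alpha> z) + fchar (- (\<beta>0 / 2)) z * (spV \<alpha> z + (-1) * spU \<alpha> z)))"
    by (intro C1_fun_mult C1_fun_add C1_fun_const C1_fun_echar U V)
  then have f: "C1_fun (\<lambda>z. fst (\<alpha> z))" by (subst fst_eq_sp) simp
  have "C1_fun (\<lambda>z. (- \<i> / 4) * (fchar (\<beta>0 / 2) z * (spU \<alpha> z + spV \<alpha> z) + (-1) * (fchar (- (\<beta>0 / 2)) z * (spV \<alpha> z + (-1) * spU \<alpha> z))))"
    by (intro C1_fun_mult C1_fun_add C1_fun_const C1_fun_echar U V)
  then have s: "C1_fun (\<lambda>z. snd (\<alpha> z))" by (subst snd_eq_sp) simp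
  obtain D1 D2 where D: "\<And>z. ((\<lambda>z. fst (\<alpha> z)) has_derivative D1 z) (at z)" "\<And>v. continuous_on UNIV (\<lambda>z. D1 z v)"
    "\<And>z. ((\<lambda>z. snd (\<alpha> z)) has_derivative D2 z) (at z)" "\<And>v. continuous_on UNIV (\<lambda>z. D2 z v)"
    using f s unfolding C1_fun_def by blast
  obtain D where D': "\<And>z. (\<alpha> has_derivative D z) (at z)" and N: "\<And>z v. D z (\<i> * v) = qmul (normalN \<beta>0 z) (D z v)"
    using wh unfolding weak_hol_def by blast
  \<comment> \<open>Uniqueness of derivatives carries the continuity of \<open>D1\<close> and
    \<open>D2\<close> over to the derivative \<open>D\<close> that satisfies the relation with
    \<open>N\<close>.\<close>
  have "D z = (\<lambda>v. (D1 z v, D2 z v))" for z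
    using has_derivative_Pair[OF D(1,3), of z] D'[of z] by (simp add: has_derivative_unique)
  then have "continuous_on UNIV (\<lambda>z. D z v)" for v by (simp add: D continuous_on_Pair)
  then have "holomorphic_q \<beta>0 \<alpha>" unfolding holomorphic_q_def using D' N by blast
  then show "\<alpha> \<in> H0 \<Gamma> \<beta>0 (\<lambda>_. 1)" using \<alpha> by (simp add: H0_def sections_def)
qed

section \<open>The four periodic sections built from constants and the torus\<close>

lemma const_in_sections: "(\<lambda>z. q) \<in> sections (\<lambda>_. 1)"
  unfolding sections_def weak_hol_def
  by (auto intro!: exI[of _ "\<lambda>z v. 0"]) (simp_all add: qmul_def rscale_eq zero_prod_def)

text \<open>Replacing \<open>v\<close> by \<open>\<i> * v\<close> in the derivative inserts an
  \<open>i\<close> behind the half-angle exponential, and \<open>normalN_expj_half\<close> moves it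
  to the front as \<open>N\<close>.\<close>

lemma HS_torus_in_sections:
  assumes "HS_torus \<Gamma> \<beta>0 f g"
  shows "f \<in> sections (\<lambda>_. 1)"
proof -
  have "qmul (qmul (expj (betaf \<beta>0 z / 2)) (qofc (\<i> * v))) (g z) =
     qmul (normalN \<beta>0 z) (qmul (qmul (expj (betaf \<beta>0 z / 2)) (qofc v)) (g z))" for z v
  proof -
    have "qofc (\<i> * v) = qmul (qofc \<i>) (qofc v)" by (simp add: qofc_def qmul_def)
    then show ?thesis by (simp only: qmul_assoc[symmetric] normalN_expj_half)
  qed
  then have "weak_hol f" using assms unfolding weak_hol_def HS_torus_def
    by (intro exI[of _ "\<lambda>z v. qmul (qmul (expj (betaf \<beta>0 z / 2)) (qofc v)) (g z)"]) auto
  then show ?thesis using assms by (auto simp: sections_def HS_torus_def rscale_eq)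
qed

text \<open>\<open>N\<close> acts from the left and so commutes with right multiplication by a
  constant quaternion. The multiplier has to be trivial here: right multiplication by
  \<open>j\<close> would turn \<open>h\<close> into its conjugate.\<close>

lemma sections_qmul_right:
  assumes "\<alpha> \<in> sections (\<lambda>_. 1)"
  shows "(\<lambda>z. qmul (\<alpha> z) q) \<in> sections (\<lambda>_. 1)"
proof -
  obtain D where D: "\<And>z. (\<alpha> has_derivative D z) (at z)" and N: "\<And>z v. D z (\<i> * v) = qmul (normalN \<beta>0 z) (D z v)"
    using assms unfolding sections_def weak_hol_def by blast
  have "((\<lambda>z. qmul (\<alpha> z) q) has_derivative (\<lambda>v. qmul (D z v) q)) (at z)" for z
    unfolding qmul_def
    by (auto intro!: derivative_eq_intros D has_derivative_fst has_derivative_snd bounded_linear.has_derivative[OF bounded_linear_cnj])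
  then have "weak_hol (\<lambda>z. qmul (\<alpha> z) q)"
    unfolding weak_hol_def by (intro exI[of _ "\<lambda>z v. qmul (D z v) q"]) (simp add: N qmul_assoc)
  then show ?thesis using assms by (simp add: sections_def rscale_eq)
qed

text \<open>Differentiating a linear relation at 0 in direction 1 removes the constants and leaves
  the quaternionic equation \<open>D 1 * (c 2 + j c 3) = 0\<close>. Since \<open>D 1\<close> is
  nonzero and quaternions have no zero divisors, \<open>c 2\<close> and \<open>c 3\<close> vanish,
  and then the constant coefficients do.\<close>

lemma four_sections:
  assumes f: "HS_torus \<Gamma> \<beta>0 f g"
  shows "c_indep_n (H0 \<Gamma> \<beta>0 (\<lambda>_. 1)) 4"
  unfolding c_indep_n_def
proof (intro exI[of _ "\<lambda>k. if k = 0 then (\<lambda>z. (1, 0)) else if k = 1 then (\<lambda>z. (0, 1)) else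
      if k = 2 then f else (\<lambda>z. qmul (f z) qj)"] conjI allI impI)
  let ?a = "\<lambda>k::nat. if k = 0 then (\<lambda>z. (1, 0)) else if k = 1 then (\<lambda>z. (0, 1)) else
      if k = 2 then f else (\<lambda>z. qmul (f z) qj)"
  note m = subsetD[OF sections_trivial_subset_H0]
  show "?a k \<in> H0 \<Gamma> \<beta>0 (\<lambda>_. 1)" for k
    using m[OF const_in_sections] m[OF HS_torus_in_sections[OF f]]
      m[OF sections_qmul_right[OF HS_torus_in_sections[OF f]]] by (simp del: split_paired_All)
  fix c :: "nat \<Rightarrow> complex" and k :: nat
  assume 0: "\<forall>z. (\<Sum>k<4. rscale (?a k z) (c k)) = 0" and "k < 4"
  have sum4: "(\<Sum>k<4. F k) = F 0 + F 1 + F 2 + F 3" for F :: "nat \<Rightarrow> quat"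
    by (simp add: eval_nat_numeral)
  have eq: "c 0 + fst (f z) * c 2 - cnj (snd (f z)) * c 3 = 0"
    "c 1 + snd (f z) * c 2 + cnj (fst (f z)) * c 3 = 0" for z
    using 0[rule_format, of z] unfolding sum4 by (simp_all add: rscale_eq qmul_def qj_def prod_eq_iff)
  define D where "D v = qmul (qmul (expj (betaf \<beta>0 0 / 2)) (qofc v)) (g 0)" for v
  have D: "(f has_derivative D) (at 0)" using f unfolding HS_torus_def D_def[abs_def] by blast
  define A B where "A = fst (D 1)" and "B = snd (D 1)"
  have AB: "A \<noteq> 0 \<or> B \<noteq> 0"
  proof -
    have "D 1 \<noteq> 0" using f qmul_expj_eq_0 unfolding D_def HS_torus_def by metis
    then show ?thesis by (auto simp: A_def B_def prod_eq_iff)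
  qed
  have d0: "((\<lambda>z. 0) has_derivative (\<lambda>v. fst (D v) * c 2 - cnj (snd (D v)) * c 3)) (at 0)"
  proof -
    have "((\<lambda>z. c 0 + fst (f z) * c 2 - cnj (snd (f z)) * c 3) has_derivative
      (\<lambda>v. fst (D v) * c 2 - cnj (snd (D v)) * c 3)) (at 0)"
      by (auto intro!: derivative_eq_intros D has_derivative_fst has_derivative_snd bounded_linear.has_derivative[OF bounded_linear_cnj])
    then show ?thesis by (simp only: eq)
  qed
  have d1: "((\<lambda>z. 0) has_derivative (\<lambda>v. snd (D v) * c 2 + cnj (fst (D v)) * c 3)) (at 0)"
  proof -
    have "((\<lambda>z. c 1 + snd (f z) * c 2 + cnj (fst (f z)) * c 3) has_derivative
      (\<lambda>v. snd (D v) * c 2 + cnj (fst (D v)) * c 3)) (at 0)"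
      by (auto intro!: derivative_eq_intros D has_derivative_fst has_derivative_snd bounded_linear.has_derivative[OF bounded_linear_cnj])
    then show ?thesis by (simp only: eq)
  qed
  have e: "A * c 2 - cnj B * c 3 = 0" "B * c 2 + cnj A * c 3 = 0"
    using has_derivative_unique[OF d0 has_derivative_const] has_derivative_unique[OF d1 has_derivative_const]
    unfolding A_def B_def by (metis)+
  have nz: "A * cnj A + B * cnj B \<noteq> 0"
  proof -
    have "A * cnj A + B * cnj B = of_real ((norm A)\<^sup>2 + (norm B)\<^sup>2)"
      unfolding of_real_add complex_norm_square ..
    moreover have "(norm A)\<^sup>2 + (norm B)\<^sup>2 \<noteq> 0" using AB by (simp add: sum_power2_eq_zero_iff)
    ultimately show ?thesis by (metis of_real_eq_0_iff)
  qed
  \<comment> \<open>These are the components of the product with the conjugate quaternion of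
    \<open>D 1\<close> from the left; the factor in front is its squared norm.\<close>
  have "(A * cnj A + B * cnj B) * c 2 = cnj A * (A * c 2 - cnj B * c 3) + cnj B * (B * c 2 + cnj A * c 3)"
    "(A * cnj A + B * cnj B) * c 3 = A * (B * c 2 + cnj A * c 3) - B * (A * c 2 - cnj B * c 3)"
    by (simp_all add: algebra_simps)
  then have "c 2 = 0" "c 3 = 0" using nz unfolding e by simp_all
  moreover from this have "c 0 = 0" "c 1 = 0" using eq[of 0] by simp_all
  moreover have "k = 0 \<or> k = 1 \<or> k = 2 \<or> k = 3" using \<open>k < 4\<close> by linarith
  ultimately show "c k = 0" by blast
qed

end

theorem theorem2p6:
  fixes \<omega>1 \<omega>2 \<beta>0 :: complex and f g :: "complex \<Rightarrow> quat"
  defines "\<Gamma> \<equiv> lattice \<omega>1 \<omega>2"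
  assumes "is_lattice_basis \<omega>1 \<omega>2"
    and "HS_torus \<Gamma> \<beta>0 f g"
  shows "(\<exists>D \<subseteq> Spec \<Gamma> \<beta>0. discrete_in \<omega>1 \<omega>2 D (Spec \<Gamma> \<beta>0) \<and>
            (\<forall>h \<in> Spec \<Gamma> \<beta>0 - D. cdim (H0 \<Gamma> \<beta>0 h) = 1))
       \<and> (\<forall>h \<in> Spec \<Gamma> \<beta>0. cdim (H0 \<Gamma> \<beta>0 h) \<le> enat (boundN \<Gamma> \<beta>0))
       \<and> (\<lambda>_. 1) \<in> Spec \<Gamma> \<beta>0 \<and> cdim (H0 \<Gamma> \<beta>0 (\<lambda>_. 1)) \<ge> 4"
proof -
  interpret hs_lattice \<omega>1 \<omega>2 \<beta>0
    using assms by unfold_locales (simp_all add: HS_torus_def)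
  have G: "\<Gamma> = lattice \<omega>1 \<omega>2" by (simp add: \<Gamma>_def)
  note torus = assms(3)[unfolded G]
  have "(\<lambda>z. (1, 0)) \<in> H0 (lattice \<omega>1 \<omega>2) \<beta>0 (\<lambda>_. 1)"
    using const_in_sections sections_trivial_subset_H0 by blast
  moreover have "(\<lambda>z::complex. (1, 0) :: quat) \<noteq> (\<lambda>z. 0)" by (simp add: fun_eq_iff zero_prod_def)
  ultimately have "(\<lambda>_. 1) \<in> Spec (lattice \<omega>1 \<omega>2) \<beta>0"
    by (auto simp: Spec_def is_multiplier_def)
  moreover have "cdim (H0 (lattice \<omega>1 \<omega>2) \<beta>0 (\<lambda>_. 1)) \<ge> 4"
    using cdim_ge[OF four_sections[OF torus]] by (simp add: numeral_eq_enat)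
  moreover have "jump \<subseteq> Spec (lattice \<omega>1 \<omega>2) \<beta>0"
    "\<forall>h \<in> Spec (lattice \<omega>1 \<omega>2) \<beta>0 - jump. cdim (H0 (lattice \<omega>1 \<omega>2) \<beta>0 h) = 1"
    by (auto simp: jump_def)
  ultimately show ?thesis
    unfolding G using discrete_jump cdim_le_boundN by blast
qed

end
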